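(* Let $N\ge 1$ and $0\le k\le r$ be integers. The triple $\left(\mathrm{Inc}_k(N-r,1^r), C, X(q)\right)$ exhibits the cyclic sieving phenomenon, where $C$ is the cyclic group of order $N-k-1$ generated by $K$-promotion $\partial$ acting on $\mathrm{Inc}_k(N-r,1^r)$ and $$X(q)=\left[\begin{array}{c}N -k-1 \\ r \end{array} \right]_q \left[\begin{array}{c}r \\ k \end{array} \right]_q.$$
   Context: For a partition $\lambda$ of $N$, an increasing $\lambda$-tableau is a filling of the Young diagram of $\lambda$ with positive integers, strictly increasing along rows and down columns, such that if $N-k$ is the largest entry then every integer $1,\dots,N-k$ appears. $\mathrm{Inc}_k(\lambda)$ is the set of such tableaux with maximum entry $N-k$. The hook shape $(N-r,1^r)$ has first row of length $N-r$ and first column of length $r+1$. $K$-promotion $\partial$ on $\mathrm{Inc}_k(N-r,1^r)$: replace the entry $1$ (in box $(1,1)$) by a dot, then repeatedly move dots: a dot with right neighbour $a$ and lower neighbour $b$ becomes: if $a<b$, $a$ moves into the dot's box and the dot moves right; if $b<a$, $b$ moves into the dot's box and the dot moves down; if $a=b$, $a$ moves into the dot's box and dots occupy both the box to the right and the box below (a dot with only one neighbour exchanges with it). Continue until every dot lies in the last box of the row or of the column; then replace each dot by $N-k$ and decrease every other entry by $1$. The Gaussian binomial is $\left[\begin{array}{c}a\\ b\end{array}\right]_q=\frac{[a]_q!}{[b]_q![a-b]_q!}$ with $[j]_q!=\prod_{i=1}^j\frac{1-q^i}{1-q}$. A triple $(X,C,X(q))$ with $X$ a finite set, $C=\langle g\rangle$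 a cyclic group of order $M$ acting on $X$, and $X(q)\in\mathbb{Z}[q]$, exhibits the cyclic sieving phenomenon if for every positive integer $d$, $X(\omega^d)=\vert\{x\in X: g^d\cdot x=x\}\vert$, where $\omega=e^{2\pi i/M}$. *)

theory Defs
  imports
    Complex_Main
    "HOL-Library.While_Combinator"
    "HOL-Library.FuncSet"
    "HOL-Computational_Algebra.Polynomial"
    "HOL-Algebra.Group_Action"
    "HOL-Algebra.Elementary_Groups"
begin

subsection \<open>Increasing tableaux\<close>

text \<open>Boxes are pairs (row, column), both numbered from 1; a partition is the list of its parts.\<close>

type_synonym box = "nat \<times> nat"

definition young_diagram :: "nat list \<Rightarrow> box set" where
  "young_diagram lam = {(i, j). 1 \<le> i \<and> i \<le> length lam \<and> 1 \<le> j \<and> j \<le> lam ! (i - 1)}"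

definition hook :: "nat \<Rightarrow> nat \<Rightarrow> nat list" where
  "hook N r = (N - r) # replicate r 1"

text \<open>A filling is \<^const>\<open>undefined\<close> outside the diagram, so that
  distinct tableaux are distinct functions.\<close>

definition increasing_tableau :: "nat list \<Rightarrow> (box \<Rightarrow> nat) \<Rightarrow> bool" where
  "increasing_tableau lam T \<longleftrightarrow>
     T \<in> extensional (young_diagram lam) \<and>
     (\<forall>p \<in> young_diagram lam. 1 \<le> T p) \<and>
     (\<forall>i j j'. (i, j) \<in> young_diagram lam \<and> (i, j') \<in> young_diagram lam \<and> j < j'
        \<longrightarrow> T (i, j) < T (i, j')) \<and>
     (\<forall>i i' j. (i, j) \<in> young_diagram lam \<and> (i', j) \<in> young_diagram lam \<and> i < i'
        \<longrightarrow> T (i, j) < T (i', j)) \<and>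
     (\<forall>m. 1 \<le> m \<and> m \<le> Max (T ` young_diagram lam) \<longrightarrow> m \<in> T ` young_diagram lam)"

text \<open>The largest entry is \<open>N - k\<close>, where \<open>N\<close> is the size of the partition; the
  additive form avoids truncated subtraction.\<close>

definition Inc :: "nat \<Rightarrow> nat list \<Rightarrow> (box \<Rightarrow> nat) set" where
  "Inc k lam = {T. increasing_tableau lam T \<and> Max (T ` young_diagram lam) + k = sum_list lam}"


subsection \<open>\<open>K\<close>-promotion\<close>

text \<open>A state \<open>(D, T)\<close> consists of the set \<open>D\<close> of boxes holding a dot and the entries \<open>T\<close> of
  the other boxes; the values of \<open>T\<close> on \<open>D\<close> carry no meaning. If the right and
  the lower neighbour of a dot are equal, the dot moves both right and down. All dots are moved
  simultaneously; in a hook shape no dot is ever next to another one, so their moves are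
  independent.\<close>

definition moves_right :: "box set \<Rightarrow> (box \<Rightarrow> nat) \<Rightarrow> box \<Rightarrow> bool" where
  "moves_right Y T = (\<lambda>(i, j). (i, j + 1) \<in> Y \<and> ((i + 1, j) \<in> Y \<longrightarrow> T (i, j + 1) \<le> T (i + 1, j)))"

definition moves_down :: "box set \<Rightarrow> (box \<Rightarrow> nat) \<Rightarrow> box \<Rightarrow> bool" where
  "moves_down Y T = (\<lambda>(i, j). (i + 1, j) \<in> Y \<and> ((i, j + 1) \<in> Y \<longrightarrow> T (i + 1, j) \<le> T (i, j + 1)))"

definition movable :: "box set \<Rightarrow> box \<Rightarrow> bool" where
  "movable Y = (\<lambda>(i, j). (i, j + 1) \<in> Y \<or> (i + 1, j) \<in> Y)"

definition move_dots :: "box set \<Rightarrow> box set \<times> (box \<Rightarrow> nat) \<Rightarrow> box set \<times> (box \<Rightarrow> nat)" where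
  "move_dots Y = (\<lambda>(D, T).
     ({p \<in> D. \<not> movable Y p}
        \<union> {(i, j + 1) | i j. (i, j) \<in> D \<and> moves_right Y T (i, j)}
        \<union> {(i + 1, j) | i j. (i, j) \<in> D \<and> moves_down Y T (i, j)},
      \<lambda>(i, j).
        if (i, j) \<in> D \<and> moves_right Y T (i, j) then T (i, j + 1)
        else if (i, j) \<in> D \<and> moves_down Y T (i, j) then T (i + 1, j)
        else T (i, j)))"

definition slide_dots :: "box set \<Rightarrow> (box \<Rightarrow> nat) \<Rightarrow> box set \<times> (box \<Rightarrow> nat)" where
  "slide_dots Y T = while (\<lambda>(D, T). \<exists>p \<in> D. movable Y p) (move_dots Y) ({(1, 1)}, T)"

definition K_promotion :: "nat list \<Rightarrow> (box \<Rightarrow> nat) \<Rightarrow> (box \<Rightarrow> nat)" where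
  "K_promotion lam T =
     (let Y = young_diagram lam; (D, T') = slide_dots Y T
      in restrict (\<lambda>p. if p \<in> D then Max (T ` Y) else T' p - 1) Y)"


subsection \<open>Gaussian binomials\<close>

definition q_fact :: "nat \<Rightarrow> int poly" where
  "q_fact n = (\<Prod>i = 1..n. (1 - monom 1 i) div (1 - monom 1 1))"

text \<open>The value is 0 for \<open>b > a\<close>, by the usual convention. Both divisions are exact in
  \<open>\<int>[q]\<close>, see the two lemmas \<open>q_int_exact\<close> and \<open>q_binomial_exact\<close> below.\<close>

definition q_binomial :: "nat \<Rightarrow> nat \<Rightarrow> int poly" where
  "q_binomial a b = (if b \<le> a then q_fact a div (q_fact b * q_fact (a - b)) else 0)"

lemma one_minus_monom_eq: "(1 - monom 1 i :: int poly) = (1 - monom 1 1) * (\<Sum>j<i. monom 1 j)"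
proof -
  have "monom (1::int) n = monom 1 1 ^ n" for n
    by (simp add: monom_power)
  then show ?thesis
    by (metis (no_types, lifting) one_diff_power_eq sum.cong)
qed

lemma one_minus_q_nonzero: "(1 - monom 1 1 :: int poly) \<noteq> 0"
proof
  assume "(1 - monom 1 1 :: int poly) = 0"
  then have "poly (1 - monom 1 1 :: int poly) 0 = 0" by simp
  then show False by (simp add: poly_monom)
qed

lemma q_int_exact:
  "(1 - monom 1 1) * ((1 - monom 1 i) div (1 - monom 1 1)) = (1 - monom 1 i :: int poly)"
  by (metis one_minus_monom_eq dvd_mult_div_cancel dvd_triv_left)

lemma q_fact_Suc:
  "q_fact (Suc n) = ((1 - monom 1 (Suc n)) div (1 - monom 1 1)) * q_fact n"
  by (simp add: q_fact_def mult.commute)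

lemma q_fact_dvd: "b \<le> a \<Longrightarrow> q_fact b * q_fact (a - b) dvd q_fact a"
proof (induction a arbitrary: b)
  case 0
  then show ?case by (simp add: q_fact_def)
next
  case (Suc a)
  define Q where "Q i = (1 - monom 1 i :: int poly) div (1 - monom 1 1)" for i
  have Q: "(1 - monom 1 1) * Q i = 1 - monom 1 i" for i
    unfolding Q_def by (rule q_int_exact)
  have fS: "q_fact (Suc n) = Q (Suc n) * q_fact n" for n
    unfolding Q_def by (rule q_fact_Suc)
  show ?case
  proof (cases "b = 0 \<or> b = Suc a")
    case True
    then show ?thesis by (auto simp: q_fact_def)
  next
    case False
    then obtain c where c: "b = Suc c" by (cases b) auto
    with False Suc.prems have ca: "Suc c \<le> a" by simp
    then obtain e where e: "a = Suc (c + e)" by (metis add_Suc less_eqE)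
    have mm: "monom (1::int) (Suc c + Suc e) = monom 1 (Suc c) * monom 1 (Suc e)"
      by (simp add: mult_monom)
    have "(1 - monom 1 1) * Q (Suc c + Suc e)
        = (1 - monom 1 1) * (Q (Suc c) + monom 1 (Suc c) * Q (Suc e))"
      unfolding distrib_left mult.left_commute[of "1 - monom 1 1" "monom 1 (Suc c)"] Q mm
      by (simp add: algebra_simps)
    then have Qs: "Q (Suc a) = Q (Suc c) + monom 1 (Suc c) * Q (Suc e)"
      using one_minus_q_nonzero e by simp
    have "q_fact c * q_fact (Suc e) dvd q_fact a"
      using Suc.IH[of c] e by (simp add: Suc_diff_le)
    then have 1: "q_fact (Suc c) * q_fact (Suc e) dvd Q (Suc c) * q_fact a"
      by (simp add: fS[of c] mult.assoc mult_dvd_mono)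
    have "q_fact (Suc c) * q_fact e dvd q_fact a"
      using Suc.IH[of "Suc c"] e by simp
    then have "Q (Suc e) * (q_fact (Suc c) * q_fact e) dvd Q (Suc e) * q_fact a"
      by (rule mult_dvd_mono[OF dvd_refl])
    then have 2: "q_fact (Suc c) * q_fact (Suc e) dvd Q (Suc e) * q_fact a"
      by (simp only: fS[of e] mult.left_commute)
    have "q_fact (Suc c) * q_fact (Suc e)
        dvd Q (Suc c) * q_fact a + monom 1 (Suc c) * (Q (Suc e) * q_fact a)"
      by (rule dvd_add[OF 1 dvd_mult[OF 2]])
    also have "\<dots> = q_fact (Suc a)"
      by (simp only: fS[of a] Qs algebra_simps)
    finally show ?thesis using c e by simp
  qed
qed

lemma q_binomial_exact:
  "b \<le> a \<Longrightarrow> q_binomial a b * (q_fact b * q_fact (a - b)) = q_fact a"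
  using q_fact_dvd[of b a] by (simp add: q_binomial_def)


subsection \<open>Cyclic sieving\<close>

text \<open>The finite group \<open>C\<close>, generated by \<open>g\<close>, acts on \<open>X\<close> through \<open>\<phi>\<close>. The action need not be
  faithful.\<close>

definition cyclic_sieving ::
    "'x set \<Rightarrow> ('g, 'm) monoid_scheme \<Rightarrow> 'g \<Rightarrow> ('g \<Rightarrow> 'x \<Rightarrow> 'x) \<Rightarrow> int poly \<Rightarrow> bool" where
  "cyclic_sieving X C g \<phi> P \<longleftrightarrow>
     finite X \<and>
     group C \<and> finite (carrier C) \<and> g \<in> carrier C \<and> subgroup_generated C {g} = C \<and>
     group_action C X \<phi> \<and>
     (\<forall>d::nat. 0 < d \<longrightarrow>
        poly (map_poly of_int P) (exp (2 * of_real pi * \<i> / of_nat (card (carrier C))) ^ d)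
          = (of_nat (card {x \<in> X. \<phi> (g [^]\<^bsub>C\<^esub> d) x = x}) :: complex))"

end

theory Submission
  imports
    "HOL-Algebra.Multiplicative_Group"
    "HOL-Number_Theory.Cong"
    "HOL-Analysis.Complex_Transcendental"
    Defs
begin

text \<open>
  Put \<open>M = N - k - 1\<close>. A tableau in \<open>Inc\<^sub>k(N - r, 1\<^sup>r)\<close> is determined by the sets of entries of its
  arm and of its leg, which cover \<open>{2..M+1}\<close> and have sizes \<open>N - r - 1\<close> and \<open>r\<close>.
  \<open>K\<close>-promotion acts on this pair of sets by the \<open>M\<close>-cycle \<open>x \<mapsto> x - 1\<close>, \<open>2 \<mapsto> M + 1\<close>,
  which under the substitution \<open>y = M + 1 - x\<close> is \<open>y \<mapsto> y + 1\<close> modulo \<open>M\<close>. Hence the tableaux fixed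
  by the \<open>d\<close>-th power correspond to pairs of sets that are periodic modulo \<open>g = gcd d M\<close>,
  and with \<open>e = M / g\<close> their number is \<open>(g choose r/e) (r/e choose k/e)\<close> if \<open>e\<close> divides both \<open>r\<close> and
  \<open>k\<close>, and 0 otherwise. The value of \<open>X(q)\<close> at a primitive \<open>e\<close>-th root of unity is the same
  number, by the \<open>q\<close>-Lucas theorem: for such \<open>q\<close>, the \<open>q\<close>-Vandermonde identity collapses to
  \<open>[n+e, b] = [n, b] + [n, b-e]\<close>, because \<open>[e, j]\<close> vanishes for \<open>0 < j < e\<close>.
\<close>

subsection \<open>Gaussian binomials at roots of unity\<close>

lemma q_fact_nonzero: "q_fact n \<noteq> 0"
proof -
  have "(1 - monom 1 i) div (1 - monom 1 1) \<noteq> (0 :: int poly)" if "i \<ge> 1" for i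
  proof
    assume "(1 - monom 1 i) div (1 - monom 1 1) = (0 :: int poly)"
    then have "(1 - monom 1 i :: int poly) = 0"
      using q_int_exact[of i] by simp
    then have "poly (1 - monom 1 i :: int poly) 0 = 0" by simp
    then show False using that by (simp add: poly_monom power_0_left)
  qed
  then show ?thesis by (auto simp: q_fact_def)
qed

lemma q_binomial_0_right [simp]: "q_binomial a 0 = 1"
  using q_binomial_exact[of 0 a] q_fact_nonzero[of a] by (simp add: q_fact_def)

lemma q_binomial_self [simp]: "q_binomial a a = 1"
  using q_binomial_exact[of a a] q_fact_nonzero[of a] by (simp add: q_fact_def)

lemma q_binomial_eq_0: "a < b \<Longrightarrow> q_binomial a b = 0"
  by (simp add: q_binomial_def)

text \<open>Over the common denominator \<open>D\<close> every term becomes a multiple of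
  \<open>q_fact a\<close>; what remains is the rule [s + t] = [s] + q^s [t] for q-integers.\<close>

lemma q_binomial_Suc_Suc:
  "q_binomial (Suc a) (Suc b) = q_binomial a b + monom 1 (Suc b) * q_binomial a (Suc b)"
proof (cases "b < a")
  case False
  then show ?thesis
    by (cases "b = a") (simp_all add: q_binomial_eq_0)
next
  case True
  then obtain e where a: "a = Suc (b + e)"
    by (metis less_imp_Suc_add)
  define Q where "Q i = (1 - monom 1 i :: int poly) div (1 - monom 1 1)" for i
  have Q: "(1 - monom 1 1) * Q i = 1 - monom 1 i" for i
    unfolding Q_def by (rule q_int_exact)
  have fS: "q_fact (Suc n) = Q (Suc n) * q_fact n" for n
    unfolding Q_def by (rule q_fact_Suc)
  have mm: "monom (1::int) (Suc b + Suc e) = monom 1 (Suc b) * monom 1 (Suc e)"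
    by (simp add: mult_monom)
  \<comment> \<open>Multiplying by 1 - q turns each q-integer \<open>Q i\<close> into
    \<open>1 - monom 1 i\<close>, so no division needs unfolding; the factor is cancelled
    afterwards.\<close>
  have "(1 - monom 1 1) * Q (Suc b + Suc e)
      = (1 - monom 1 1) * (Q (Suc b) + monom 1 (Suc b) * Q (Suc e))"
    unfolding distrib_left mult.left_commute[of "1 - monom 1 1" "monom 1 (Suc b)"] Q mm
    by (simp add: algebra_simps)
  then have Qs: "Q (Suc a) = Q (Suc b) + monom 1 (Suc b) * Q (Suc e)"
    using one_minus_q_nonzero a by simp
  define D where "D = q_fact (Suc b) * q_fact (Suc e)"
  have 1: "q_binomial (Suc a) (Suc b) * D = q_fact (Suc a)"
    using q_binomial_exact[of "Suc b" "Suc a"] a by (simp add: D_def)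
  have 2: "q_binomial a b * (q_fact b * q_fact (Suc e)) = q_fact a"
    using q_binomial_exact[of b a] a by (simp add: Suc_diff_le)
  have 3: "q_binomial a (Suc b) * (q_fact (Suc b) * q_fact e) = q_fact a"
    using q_binomial_exact[of "Suc b" a] a by simp
  have "q_binomial a b * D = Q (Suc b) * (q_binomial a b * (q_fact b * q_fact (Suc e)))"
    by (simp add: D_def fS[of b] mult_ac)
  then have 4: "q_binomial a b * D = Q (Suc b) * q_fact a"
    by (simp only: 2)
  have "q_binomial a (Suc b) * D = Q (Suc e) * (q_binomial a (Suc b) * (q_fact (Suc b) * q_fact e))"
    by (simp add: D_def fS[of e] mult_ac)
  then have 5: "q_binomial a (Suc b) * D = Q (Suc e) * q_fact a"
    by (simp only: 3)
  have "q_binomial (Suc a) (Suc b) * D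
      = (q_binomial a b + monom 1 (Suc b) * q_binomial a (Suc b)) * D"
    by (simp only: 1 fS[of a] Qs distrib_right 4 5 mult.assoc)
  moreover have "D \<noteq> 0"
    by (simp add: D_def q_fact_nonzero)
  ultimately show ?thesis by simp
qed

section \<open>The evaluation homomorphism from \<int>[q] to the complex numbers\<close>

definition int_poly_eval :: "complex \<Rightarrow> int poly \<Rightarrow> complex" where
  "int_poly_eval z p = poly (map_poly of_int p) z"

lemma int_poly_eval_0 [simp]: "int_poly_eval z 0 = 0"
  by (simp add: int_poly_eval_def)

lemma int_poly_eval_monom [simp]: "int_poly_eval z (monom c n) = of_int c * z ^ n"
  by (simp add: int_poly_eval_def map_poly_monom poly_monom)

lemma int_poly_eval_1 [simp]: "int_poly_eval z 1 = 1"
  using int_poly_eval_monom[of z 1 0] by simp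

lemma int_poly_eval_pCons [simp]: "int_poly_eval z (pCons c p) = of_int c + z * int_poly_eval z p"
  by (simp add: int_poly_eval_def map_poly_pCons)

lemma int_poly_eval_add [simp]: "int_poly_eval z (p + q) = int_poly_eval z p + int_poly_eval z q"
proof -
  have "map_poly of_int (p + q) = map_poly of_int p + (map_poly of_int q :: complex poly)"
    by (rule poly_eqI) (simp add: coeff_map_poly)
  then show ?thesis by (simp add: int_poly_eval_def)
qed

lemma int_poly_eval_smult [simp]: "int_poly_eval z (smult c p) = of_int c * int_poly_eval z p"
  by (induction p) (simp_all add: algebra_simps)

lemma int_poly_eval_mult [simp]: "int_poly_eval z (p * q) = int_poly_eval z p * int_poly_eval z q"
  by (induction p) (simp_all add: algebra_simps)

lemma int_poly_eval_sum [simp]: "int_poly_eval z (sum f S) = (\<Sum>x\<in>S. int_poly_eval z (f x))"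
  by (induction S rule: infinite_finite_induct) simp_all

lemma int_poly_eval_prod [simp]: "int_poly_eval z (prod f S) = (\<Prod>x\<in>S. int_poly_eval z (f x))"
  by (induction S rule: infinite_finite_induct) simp_all

lemma int_poly_eval_q_fact: "int_poly_eval z (q_fact n) = (\<Prod>i=1..n. \<Sum>j<i. z ^ j)"
proof -
  have "(1 - monom 1 i) div (1 - monom 1 1) = (\<Sum>j<i. monom 1 j :: int poly)" for i
    using q_int_exact[of i] one_minus_monom_eq[of i] one_minus_q_nonzero
    by (metis mult_left_cancel)
  then show ?thesis by (simp add: q_fact_def)
qed

lemma int_poly_eval_q_binomial_Suc_Suc:
  "int_poly_eval z (q_binomial (Suc a) (Suc b))
     = int_poly_eval z (q_binomial a b) + z ^ Suc b * int_poly_eval z (q_binomial a (Suc b))"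
  by (simp add: q_binomial_Suc_Suc)

text \<open>Induction on \<open>m\<close>, with the q-Pascal rule applied on both sides. Where
  \<open>m < j\<close>, the truncated \<open>m - j\<close> in the exponent is harmless because
  \<open>q_binomial m j\<close> is 0.\<close>

lemma q_Vandermonde:
  "int_poly_eval z (q_binomial (n + m) b)
     = (\<Sum>j\<le>b. z ^ ((b - j) * (m - j)) * int_poly_eval z (q_binomial m j)
                 * int_poly_eval z (q_binomial n (b - j)))"
proof (induction m arbitrary: b)
  case 0
  have "(\<Sum>j\<le>b. z ^ ((b - j) * (0 - j)) * int_poly_eval z (q_binomial 0 j)
                 * int_poly_eval z (q_binomial n (b - j)))
      = (\<Sum>j\<in>{0}. z ^ ((b - j) * (0 - j)) * int_poly_eval z (q_binomial 0 j)
                 * int_poly_eval z (q_binomial n (b - j)))"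
    by (rule sum.mono_neutral_right) (auto simp: q_binomial_eq_0)
  then show ?case by simp
next
  case (Suc m)
  define G where "G a b = int_poly_eval z (q_binomial a b)" for a b
  have G0 [simp]: "G a 0 = 1" for a by (simp add: G_def)
  have GS: "G (Suc a) (Suc b) = G a b + z ^ Suc b * G a (Suc b)" for a b
    unfolding G_def by (rule int_poly_eval_q_binomial_Suc_Suc)
  have Gz: "G a b = 0" if "a < b" for a b
    using that by (simp add: G_def q_binomial_eq_0)
  note IH = Suc.IH[folded G_def]
  show ?case
  proof (cases b)
    case 0
    then show ?thesis by simp
  next
    case (Suc c)
    \<comment> \<open>\<open>f\<close> and \<open>h\<close> are the summands of the two terms that
      the q-Pascal rule produces on the left, expanded by the induction hypothesis. Term
      \<open>Suc j\<close> of the required sum is \<open>f j + h (Suc j)\<close>, and term 0 is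
      \<open>h 0\<close>.\<close>
    define f where "f j = z ^ ((c - j) * (m - j)) * G m j * G n (c - j)" for j
    define h where "h j = z ^ Suc c * (z ^ ((Suc c - j) * (m - j)) * G m j * G n (Suc c - j))" for j
    have step: "z ^ ((Suc c - Suc j) * (Suc m - Suc j)) * G (Suc m) (Suc j) * G n (Suc c - Suc j)
        = f j + h (Suc j)" if jc: "j \<le> c" for j
    proof (cases "Suc j \<le> m")
      case True
      \<comment> \<open>Writing \<open>m\<close> and \<open>c\<close> as sums removes the truncated
        differences from the exponents.\<close>
      then obtain t where t: "m = Suc j + t" using le_Suc_ex by blast
      obtain s where s: "c = j + s" using jc le_Suc_ex by blast
      show ?thesis
        unfolding f_def h_def GS t s
        by (simp add: algebra_simps power_add)
    next
      case False
      then show ?thesis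
        by (simp add: f_def h_def GS Gz)
    qed
    have "G (n + Suc m) (Suc c) = (\<Sum>j\<le>c. f j) + (\<Sum>j\<le>Suc c. h j)"
      unfolding h_def f_def sum_distrib_left[symmetric] IH[symmetric]
      by (simp add: GS)
    also have "\<dots> = h 0 + (\<Sum>j\<le>c. f j + h (Suc j))"
      by (simp add: sum.atMost_Suc_shift sum.distrib del: sum.atMost_Suc)
    also have "(\<Sum>j\<le>c. f j + h (Suc j)) = (\<Sum>j\<le>c. z ^ ((Suc c - Suc j) * (Suc m - Suc j))
        * G (Suc m) (Suc j) * G n (Suc c - Suc j))"
      by (rule sum.cong) (simp_all only: step atMost_iff)
    also have "h 0 = z ^ ((Suc c - 0) * (Suc m - 0)) * G (Suc m) 0 * G n (Suc c - 0)"
      by (simp add: h_def power_add mult_ac)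
    finally show ?thesis
      unfolding Suc G_def by (simp only: sum.atMost_Suc_shift)
  qed
qed

text \<open>The first assumption says that \<open>z\<close> has multiplicative order
  \<open>e\<close>. With \<open>e \<noteq> 1\<close> it excludes \<open>z = 1\<close>, so the closed
  form of the geometric sum applies.\<close>

lemma geometric_sum_eq_0_iff:
  fixes z :: complex
  assumes "\<And>j. z ^ j = 1 \<longleftrightarrow> e dvd j" "e \<noteq> 1"
  shows "(\<Sum>j<i. z ^ j) = 0 \<longleftrightarrow> e dvd i"
proof -
  have "z \<noteq> 1" using assms(1)[of 1] assms(2) by simp
  then have "(\<Sum>j<i. z ^ j) = 0 \<longleftrightarrow> z ^ i = 1"
    by (simp add: geometric_sum)
  then show ?thesis by (simp add: assms)
qed

text \<open>Among the q-integers [1], ..., [e] only [e] vanishes at \<open>z\<close>, so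
  \<open>q_fact e\<close> vanishes there but the denominator does not.\<close>

lemma q_binomial_root_of_unity_eq_0:
  assumes root: "\<And>j. z ^ j = 1 \<longleftrightarrow> e dvd j" and "0 < j" "j < e"
  shows "int_poly_eval z (q_binomial e j) = 0"
proof -
  have e: "e \<noteq> 1" using assms by auto
  note geo = geometric_sum_eq_0_iff[OF root e]
  have nz: "int_poly_eval z (q_fact n) \<noteq> 0" if "n < e" for n
    using that by (auto simp: int_poly_eval_q_fact geo dest: dvd_imp_le)
  have "int_poly_eval z (q_fact e) = 0"
    unfolding int_poly_eval_q_fact
    by (rule prod_zero, simp, rule bexI[of _ e]) (use \<open>j < e\<close> geo[of e] in auto)
  moreover have "int_poly_eval z (q_binomial e j) *
      (int_poly_eval z (q_fact j) * int_poly_eval z (q_fact (e - j))) = int_poly_eval z (q_fact e)"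
    using q_binomial_exact[of j e] \<open>j < e\<close> by (simp flip: int_poly_eval_mult)
  ultimately show ?thesis
    using nz[of j] nz[of "e - j"] \<open>0 < j\<close> \<open>j < e\<close> by simp
qed

text \<open>q-Vandermonde with \<open>m = e\<close>. The surviving terms \<open>j = 0\<close> and
  \<open>j = e\<close> carry the powers \<open>z ^ (b * e) = 1\<close> and \<open>z ^ 0 = 1\<close>;
  the second is in range only if \<open>e \<le> b\<close>.\<close>

lemma q_binomial_root_of_unity_add:
  assumes root: "\<And>j. z ^ j = 1 \<longleftrightarrow> e dvd j" and "0 < e"
  shows "int_poly_eval z (q_binomial (n + e) b)
    = int_poly_eval z (q_binomial n b) +
      (if e \<le> b then int_poly_eval z (q_binomial n (b - e)) else 0)"
proof -
  define F where "F j = z ^ ((b - j) * (e - j)) * int_poly_eval z (q_binomial e j)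
                 * int_poly_eval z (q_binomial n (b - j))" for j
  have "F j = 0" if "j \<noteq> 0" "j \<noteq> e" for j
    using that q_binomial_root_of_unity_eq_0[OF root, of j]
    by (cases "j < e") (auto simp: F_def q_binomial_eq_0)
  then have "(\<Sum>j\<le>b. F j) = (\<Sum>j\<in>{0, e} \<inter> {..b}. F j)"
    by (intro sum.mono_neutral_right) auto
  also have "\<dots> = F 0 + (if e \<le> b then F e else 0)"
    using \<open>0 < e\<close> by auto
  also have "F 0 = int_poly_eval z (q_binomial n b)"
    using root[of "b * e"] by (simp add: F_def)
  also have "F e = int_poly_eval z (q_binomial n (b - e))"
    by (simp add: F_def)
  finally show ?thesis
    by (simp add: q_Vandermonde F_def)
qed

text \<open>Induction on \<open>m\<close>: the recurrence just proved is Pascal's rule for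
  \<open>m choose (b div e)\<close>. Upper indices divisible by \<open>e\<close> are enough, since
  \<open>M\<close> is one, and \<open>r\<close> is one unless the first factor of X(q)
  vanishes.\<close>

theorem q_Lucas:
  assumes root: "\<And>j. z ^ j = 1 \<longleftrightarrow> e dvd j" and "0 < e"
  shows "int_poly_eval z (q_binomial (m * e) b)
    = (if e dvd b then of_nat (m choose (b div e)) else 0)"
proof (induction m arbitrary: b)
  case 0
  show ?case
  proof (cases "b = 0")
    case False
    then have "e dvd b \<Longrightarrow> b div e > 0"
      using \<open>0 < e\<close> by (auto simp: dvd_div_eq_0_iff)
    then show ?thesis using False by (auto simp: q_binomial_eq_0 binomial_eq_0)
  qed simp
next
  case (Suc m)
  have eq: "int_poly_eval z (q_binomial (Suc m * e) b)
      = int_poly_eval z (q_binomial (m * e) b) +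
      (if e \<le> b then int_poly_eval z (q_binomial (m * e) (b - e)) else 0)"
    using q_binomial_root_of_unity_add[OF assms, of "m * e" b] by (simp add: add.commute)
  show ?case
  proof (cases "e \<le> b")
    case True
    then obtain c where "b = c + e" by (metis add.commute le_Suc_ex)
    then show ?thesis
      unfolding eq Suc.IH using \<open>0 < e\<close> by simp
  next
    case False
    then have "b < e" by simp
    then show ?thesis
      unfolding eq Suc.IH using \<open>0 < e\<close> by (auto dest: dvd_imp_le)
  qed
qed

text \<open>The exponent \<open>d * j\<close> counts modulo \<open>M\<close>. Dividing
  \<open>d\<close> and \<open>M\<close> by their gcd leaves coprime \<open>u\<close> and
  \<open>v\<close>, so the condition becomes \<open>v dvd j\<close>.\<close>

lemma exp_root_of_unity_power_eq_1_iff: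
  fixes M d j :: nat
  assumes "0 < M"
  shows "(exp (2 * of_real pi * \<i> / of_nat M) ^ d) ^ j = 1 \<longleftrightarrow> M div gcd d M dvd j"
proof -
  have "(exp (2 * of_real pi * \<i> / of_nat M) ^ d) ^ j
      = exp (2 * of_real pi * \<i> * of_nat (d * j) / of_nat M)"
    by (simp add: power_mult[symmetric] exp_of_nat_mult[symmetric] mult_ac)
  also have "\<dots> = 1 \<longleftrightarrow> M dvd d * j"
    using assms complex_root_unity_eq_1[of M "d * j"] by simp
  also have "\<dots> \<longleftrightarrow> M div gcd d M dvd j"
  proof -
    obtain u v where uv: "d = u * gcd d M" "M = v * gcd d M" "coprime u v"
      using gcd_coprime_exists[of d M] assms by auto
    have g: "gcd d M > 0" using assms by simp
    have "M dvd d * j \<longleftrightarrow> v * gcd d M dvd (u * j) * gcd d M"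
      by (subst uv(2), subst uv(1)) (simp add: mult_ac)
    also have "\<dots> \<longleftrightarrow> v dvd u * j"
      using g by simp
    also have "\<dots> \<longleftrightarrow> v dvd j"
      using uv(3) by (simp add: coprime_dvd_mult_right_iff coprime_commute)
    also have "v = M div gcd d M"
      using g uv(2) by (metis nonzero_mult_div_cancel_right less_numeral_extra(3))
    finally show ?thesis .
  qed
  finally show ?thesis .
qed

subsection \<open>Rotation-invariant pairs of subsets\<close>

lemma inj_on_mod_shift: "inj_on (\<lambda>x. (x + d) mod M) {..<M}" for M d :: nat
proof (rule inj_onI)
  fix x y assume "x \<in> {..<M}" "y \<in> {..<M}" "(x + d) mod M = (y + d) mod M"
  then show "x = y"
    by (metis cong_add_rcancel_nat cong_def lessThan_iff mod_less)
qed

lemma mod_shift_image: "0 < M \<Longrightarrow> (\<lambda>x. (x + d) mod M) ` {..<M} = {..<M}" for M d :: nat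
  by (intro endo_inj_surj inj_on_mod_shift) auto

text \<open>Modulo \<open>M\<close>, the multiples of \<open>d\<close> are exactly the multiples of
  \<open>gcd d M\<close>, so iterating the shift by \<open>d\<close> reaches every shift by a
  multiple of the gcd.\<close>

lemma mod_shift_invariant_iff_periodic:
  fixes M d :: nat
  assumes "0 < M" and A: "A \<subseteq> {..<M}"
  shows "(\<lambda>x. (x + d) mod M) ` A = A \<longleftrightarrow>
    (\<forall>x<M. \<forall>y<M. x mod gcd d M = y mod gcd d M \<longrightarrow> x \<in> A \<longrightarrow> y \<in> A)"
proof
  assume inv: "(\<lambda>x. (x + d) mod M) ` A = A"
  have iter: "(x + d * t) mod M \<in> A" if "x \<in> A" for x t
  proof (induction t)
    case 0
    then show ?case using that A by auto
  next
    case (Suc t)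
    then have "((x + d * t) mod M + d) mod M \<in> A"
      using inv by blast
    then show ?case by (simp add: mod_simps add_ac)
  qed
  show "\<forall>x<M. \<forall>y<M. x mod gcd d M = y mod gcd d M \<longrightarrow> x \<in> A \<longrightarrow> y \<in> A"
  proof (intro allI impI)
    fix x y
    assume xy: "x < M" "y < M" "x mod gcd d M = y mod gcd d M" "x \<in> A"
    \<comment> \<open>Adding \<open>M\<close>, a multiple of the gcd, keeps \<open>y + M - x\<close>
      from truncating. By Bezout this difference is congruent to a multiple \<open>d * t\<close>,
      and \<open>t\<close> shifts lead from \<open>x\<close> to \<open>y\<close>.\<close>
    have "[x = y + M] (mod gcd d M)"
      using xy(3) by (simp add: cong_def mod_add_eq[symmetric, of y M])
    then have "gcd d M dvd y + M - x"
      using xy(1) cong_altdef_nat[of x "y + M" "gcd d M"] by (simp add: cong_sym_eq)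
    then obtain t where "[d * t = y + M - x] (mod M)"
      using cong_solve_dvd_nat by blast
    then have "[x + d * t = x + (y + M - x)] (mod M)"
      by (rule cong_add[OF cong_refl])
    then have "(x + d * t) mod M = y"
      using xy(1,2) by (simp add: cong_def)
    then show "y \<in> A" using iter[OF xy(4), of t] by simp
  qed
next
  assume per: "\<forall>x<M. \<forall>y<M. x mod gcd d M = y mod gcd d M \<longrightarrow> x \<in> A \<longrightarrow> y \<in> A"
  have fin: "finite A" using A finite_subset by blast
  have sub: "(\<lambda>x. (x + d) mod M) ` A \<subseteq> A"
  proof (rule image_subsetI)
    fix x assume "x \<in> A"
    have "(x + d) mod M mod gcd d M = (x + d) mod gcd d M"
      by (simp add: mod_mod_cancel)
    also have "\<dots> = x mod gcd d M"
      by (metis gcd_dvd1 mod_add_right_eq dvd_imp_mod_0 add.right_neutral)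
    finally show "(x + d) mod M \<in> A"
      using per \<open>x \<in> A\<close> A \<open>0 < M\<close> by (metis lessThan_iff mod_less_divisor subsetD)
  qed
  have "inj_on (\<lambda>x. (x + d) mod M) A"
    using inj_on_mod_shift A by (rule inj_on_subset)
  with fin sub show "(\<lambda>x. (x + d) mod M) ` A = A"
    by (simp add: endo_inj_surj)
qed

definition periodic_lift :: "nat \<Rightarrow> nat \<Rightarrow> nat set \<Rightarrow> nat set" where
  "periodic_lift g M S = {x. x < M \<and> x mod g \<in> S}"

text \<open>Division with remainder by \<open>g\<close> splits \<open>{..<e * g}\<close> into
  \<open>e\<close> blocks, each containing one translate of \<open>S\<close>.\<close>

lemma card_periodic_lift:
  assumes "0 < g" "S \<subseteq> {..<g}"
  shows "card (periodic_lift g (e * g) S) = e * card S"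
proof -
  have "bij_betw (\<lambda>(q, s). q * g + s) ({..<e} \<times> S) (periodic_lift g (e * g) S)"
  proof (rule bij_betw_byWitness[where f' = "\<lambda>x. (x div g, x mod g)"])
    show "(\<lambda>(q, s). q * g + s) ` ({..<e} \<times> S) \<subseteq> periodic_lift g (e * g) S"
    proof safe
      fix q s assume "q < e" "s \<in> S"
      then have "s < g" "Suc q \<le> e" using assms by auto
      then have "q * g + s < Suc q * g" "Suc q * g \<le> e * g" by (simp, intro mult_right_mono) auto
      then show "q * g + s \<in> periodic_lift g (e * g) S"
        using \<open>s < g\<close> \<open>s \<in> S\<close> by (auto simp: periodic_lift_def)
    qed
  qed (use assms in \<open>auto simp: periodic_lift_def less_mult_imp_div_less\<close>)
  then have "card ({..<e} \<times> S) = card (periodic_lift g (e * g) S)"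
    by (rule bij_betw_same_card)
  then show ?thesis by (simp add: card_cartesian_product)
qed

text \<open>An invariant set is periodic modulo \<open>g\<close>, hence recovered from its part
  \<open>A \<inter> {..<g}\<close> in the first period.\<close>

lemma bij_betw_periodic_lift:
  assumes M: "0 < M" and g: "g = gcd d M"
  shows "bij_betw (periodic_lift g M) (Pow {..<g})
    {A. A \<subseteq> {..<M} \<and> (\<lambda>x. (x + d) mod M) ` A = A}"
proof (rule bij_betw_byWitness[where f' = "\<lambda>A. A \<inter> {..<g}"])
  have g0: "0 < g" and gM: "g \<le> M"
    using assms by (auto intro: dvd_imp_le)
  show "\<forall>S\<in>Pow {..<g}. periodic_lift g M S \<inter> {..<g} = S"
    using gM by (auto simp: periodic_lift_def)
  have "periodic_lift g M (A \<inter> {..<g}) = A"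
    if "A \<subseteq> {..<M}" "(\<lambda>x. (x + d) mod M) ` A = A" for A
  proof -
    have per: "y \<in> A" if "x < M" "y < M" "x mod g = y mod g" "x \<in> A" for x y
      using mod_shift_invariant_iff_periodic[OF M \<open>A \<subseteq> {..<M}\<close>, of d] g that
        \<open>(\<lambda>x. (x + d) mod M) ` A = A\<close> by metis
    have small: "x mod g < g" "x mod g < M" for x
      using g0 gM less_le_trans[OF mod_less_divisor[OF g0] gM] by auto
    have "x mod g \<in> A \<longleftrightarrow> x \<in> A" if "x < M" for x
      using per[of x "x mod g"] per[of "x mod g" x] small[of x] that by auto
    then show ?thesis
      using \<open>A \<subseteq> {..<M}\<close> small by (auto simp: periodic_lift_def)
  qed
  then show "\<forall>A\<in>{A. A \<subseteq> {..<M} \<and> (\<lambda>x. (x + d) mod M) ` A = A}. periodic_lift g M (A \<inter> {..<g}) = A"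
    by blast
  show "periodic_lift g M ` Pow {..<g} \<subseteq> {A. A \<subseteq> {..<M} \<and> (\<lambda>x. (x + d) mod M) ` A = A}"
  proof (clarify, intro conjI)
    fix S
    show sub: "periodic_lift g M S \<subseteq> {..<M}" by (auto simp: periodic_lift_def)
    show "(\<lambda>x. (x + d) mod M) ` periodic_lift g M S = periodic_lift g M S"
      unfolding mod_shift_invariant_iff_periodic[OF M sub] by (auto simp: periodic_lift_def g)
  qed
qed auto

lemma periodic_lift_mono_iff:
  assumes "S \<subseteq> {..<g}" "g \<le> M"
  shows "periodic_lift g M S \<subseteq> periodic_lift g M S' \<longleftrightarrow> S \<subseteq> S'"
proof
  assume sub: "periodic_lift g M S \<subseteq> periodic_lift g M S'"
  show "S \<subseteq> S'"
  proof
    fix x assume "x \<in> S"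
    then have "x < g" "x \<in> periodic_lift g M S"
      using assms by (auto simp: periodic_lift_def)
    then show "x \<in> S'"
      using sub by (auto simp: periodic_lift_def)
  qed
qed (auto simp: periodic_lift_def)

section \<open>Counting invariant pairs of sets\<close>

lemma card_nested_subsets:
  assumes "finite S"
  shows "card {(B, K). K \<subseteq> B \<and> B \<subseteq> S \<and> card B = b \<and> card K = c}
    = (card S choose b) * (b choose c)"
proof -
  have "{(B, K). K \<subseteq> B \<and> B \<subseteq> S \<and> card B = b \<and> card K = c}
      = (SIGMA B:{B. B \<subseteq> S \<and> card B = b}. {K. K \<subseteq> B \<and> card K = c})"
    by auto
  moreover have "card {K. K \<subseteq> B \<and> card K = c} = b choose c" if "B \<subseteq> S" "card B = b" for B
    using n_subsets[OF finite_subset[OF that(1) assms]] that(2) by simp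
  moreover have "finite {K. K \<subseteq> B \<and> card K = c}" if "B \<subseteq> S" for B
    using finite_subset[OF that assms] by simp
  ultimately show ?thesis
    using assms by (simp add: n_subsets)
qed

text \<open>Lifting from \<open>{..<g}\<close> preserves inclusion and multiplies cardinalities by
  \<open>e\<close>, which reduces the count to nested subsets of a \<open>g\<close>-element
  set.\<close>

lemma card_invariant_nested_subsets:
  fixes M d r k :: nat
  assumes M: "0 < M" and g: "g = gcd d M" and e: "e = M div g"
  shows "card {(B, K). K \<subseteq> B \<and> B \<subseteq> {..<M} \<and> card B = r \<and> card K = k \<and>
      (\<lambda>x. (x + d) mod M) ` B = B \<and> (\<lambda>x. (x + d) mod M) ` K = K}
    = (if e dvd r \<and> e dvd k then (g choose (r div e)) * ((r div e) choose (k div e)) else 0)"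
proof -
  let ?s = "\<lambda>x. (x + d) mod M"
  let ?inv = "{A. A \<subseteq> {..<M} \<and> ?s ` A = A}"
  let ?L = "periodic_lift g M"
  \<comment> \<open>With \<open>e * card B = r\<close> instead of \<open>card B = r div e\<close>,
    the set is empty when divisibility fails, which gives the value 0.\<close>
  let ?Q = "{(B, K). K \<subseteq> B \<and> B \<subseteq> {..<g} \<and> e * card B = r \<and> e * card K = k}"
  let ?P = "{(B, K). K \<subseteq> B \<and> B \<subseteq> {..<M} \<and> card B = r \<and> card K = k \<and>
      ?s ` B = B \<and> ?s ` K = K}"
  have g0: "0 < g" and gM: "g \<le> M" and eg: "M = e * g"
    using assms by (auto intro: dvd_imp_le)
  have e0: "0 < e" using eg M by (cases e) auto
  note bij = bij_betw_periodic_lift[OF M g]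
  have cardL: "card (?L S) = e * card S" if "S \<subseteq> {..<g}" for S
    using card_periodic_lift[OF g0 that, of e] eg by simp
  have "bij_betw (map_prod ?L ?L) ?Q ?P"
  proof (rule bij_betw_imageI)
    have "inj_on (map_prod ?L ?L) (Pow {..<g} \<times> Pow {..<g})"
      using bij by (intro map_prod_inj_on) (auto simp: bij_betw_def)
    then show "inj_on (map_prod ?L ?L) ?Q"
      by (rule inj_on_subset) auto
    show "map_prod ?L ?L ` ?Q = ?P"
    proof (intro equalityI subsetI)
      fix p assume "p \<in> map_prod ?L ?L ` ?Q"
      then obtain B K where p: "p = (?L B, ?L K)" "K \<subseteq> B" "B \<subseteq> {..<g}" "e * card B = r" "e * card K = k"
        by auto
      have K: "K \<subseteq> {..<g}" using p by blast
      have "?L B \<in> ?inv" "?L K \<in> ?inv"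
        using bij_betw_imp_surj_on[OF bij] p(3) K by blast+
      then show "p \<in> ?P"
        using p K cardL periodic_lift_mono_iff[OF K gM] by auto
    next
      fix p assume "p \<in> ?P"
      then obtain B K where p: "p = (B, K)" "K \<subseteq> B" "B \<subseteq> {..<M}" "card B = r" "card K = k"
        "?s ` B = B" "?s ` K = K" by auto
      then have "B \<in> ?inv" "K \<in> ?inv" by auto
      then have "B \<in> ?L ` Pow {..<g}" "K \<in> ?L ` Pow {..<g}"
        using bij_betw_imp_surj_on[OF bij] by auto
      then obtain B' K' where BK: "B = ?L B'" "K = ?L K'" "B' \<subseteq> {..<g}" "K' \<subseteq> {..<g}"
        by auto
      have "K' \<subseteq> B'"
        using p(2) periodic_lift_mono_iff[OF BK(4) gM] unfolding BK by simp
      then show "p \<in> map_prod ?L ?L ` ?Q"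
        using p BK cardL by (auto intro!: image_eqI[of _ _ "(B', K')"])
    qed
  qed
  then have "card ?P = card ?Q"
    by (rule bij_betw_same_card[symmetric])
  also have "\<dots> = (if e dvd r \<and> e dvd k then (g choose (r div e)) * ((r div e) choose (k div e)) else 0)"
  proof (cases "e dvd r \<and> e dvd k")
    case True
    then have "?Q = {(B, K). K \<subseteq> B \<and> B \<subseteq> {..<g} \<and> card B = r div e \<and> card K = k div e}"
      using e0 by auto
    then show ?thesis
      using True card_nested_subsets[of "{..<g}" "r div e" "k div e"] by simp
  next
    case False
    then have "?Q = {}" by auto
    then have "card ?Q = 0" by (simp only: card.empty)
    then show ?thesis unfolding if_not_P[OF False] .
  qed
  finally show ?thesis .
qed

text \<open>A covering pair amounts to the nested pair \<open>(B, A \<inter> B)\<close>: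
  \<open>A\<close> is the complement of \<open>B\<close> together with \<open>A \<inter> B\<close>,
  and \<open>a + r = M + k\<close> forces the intersection to have \<open>k\<close> elements.
  Invariance carries over because the shift is injective.\<close>

lemma card_invariant_covering_pairs:
  fixes M d a r k :: nat
  assumes M: "0 < M" and g: "g = gcd d M" and e: "e = M div g" and size: "a + r = M + k" "k \<le> r"
  shows "card {(A, B). A \<union> B = {..<M} \<and> card A = a \<and> card B = r \<and>
      (\<lambda>x. (x + d) mod M) ` A = A \<and> (\<lambda>x. (x + d) mod M) ` B = B}
    = (if e dvd r \<and> e dvd k then (g choose (r div e)) * ((r div e) choose (k div e)) else 0)"
proof -
  let ?s = "\<lambda>x. (x + d) mod M"
  let ?P = "{(B, K). K \<subseteq> B \<and> B \<subseteq> {..<M} \<and> card B = r \<and> card K = k \<and>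
      ?s ` B = B \<and> ?s ` K = K}"
  let ?R = "{(A, B). A \<union> B = {..<M} \<and> card A = a \<and> card B = r \<and> ?s ` A = A \<and> ?s ` B = B}"
  note inj = inj_on_mod_shift[of d M] and surj = mod_shift_image[OF M, of d]
  have "bij_betw (\<lambda>(A, B). (B, A \<inter> B)) ?R ?P"
  proof (rule bij_betw_byWitness[where f' = "\<lambda>(B, K). (({..<M} - B) \<union> K, B)"])
    show "(\<lambda>(A, B). (B, A \<inter> B)) ` ?R \<subseteq> ?P"
    proof clarify
      fix A B assume AB: "A \<union> B = {..<M}" "?s ` A = A" "?s ` B = B" "a = card A" "r = card B"
      have fin: "finite A" "finite B" using AB(1) by (metis finite_Un finite_lessThan)+
      have "card (A \<inter> B) = k"
        using card_Un_Int[OF fin] AB size by simp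
      moreover have "?s ` (A \<inter> B) = A \<inter> B"
        using inj_on_image_Int[OF inj, of A B] AB by auto
      ultimately show "A \<inter> B \<subseteq> B \<and> B \<subseteq> {..<M} \<and> card B = card B \<and> card (A \<inter> B) = k \<and>
          ?s ` B = B \<and> ?s ` (A \<inter> B) = A \<inter> B"
        using AB by auto
    qed
    show "(\<lambda>(B, K). (({..<M} - B) \<union> K, B)) ` ?P \<subseteq> ?R"
    proof clarify
      fix B K assume BK: "K \<subseteq> B" "B \<subseteq> {..<M}" "?s ` B = B" "?s ` K = K" "r = card B" "k = card K"
      have fin: "finite B" "finite K" using BK by (meson finite_lessThan finite_subset)+
      have "card (({..<M} - B) \<union> K) = card ({..<M} - B) + card K"
        using fin BK by (intro card_Un_disjoint) auto
      also have "card ({..<M} - B) = M - card B"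
        using BK fin by (simp add: card_Diff_subset)
      also have "M - card B + card K = a"
        using size BK card_mono[OF _ BK(2)] by simp
      finally have "card (({..<M} - B) \<union> K) = a" .
      moreover have "?s ` ({..<M} - B) = {..<M} - B"
        using inj_on_image_set_diff[OF inj, of "{..<M}" B] BK surj by auto
      ultimately show "({..<M} - B \<union> K) \<union> B = {..<M} \<and> card ({..<M} - B \<union> K) = a \<and> card B = card B \<and>
          ?s ` ({..<M} - B \<union> K) = {..<M} - B \<union> K \<and> ?s ` B = B"
        using BK by (auto simp only: image_Un)
    qed
  qed auto
  then have "card ?R = card ?P"
    by (rule bij_betw_same_card)
  then show ?thesis
    using card_invariant_nested_subsets[OF M g e, of r k] by simp
qed

subsection \<open>Rotation of increasing sequences\<close>

lemma strict_mono_on_lessThan_unique: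
  fixes f h :: "nat \<Rightarrow> nat"
  assumes "strict_mono_on {..<a} f" "strict_mono_on {..<a} h" "f ` {..<a} = h ` {..<a}" "j < a"
  shows "f j = h j"
proof -
  have "sorted_wrt (<) (map f [0..<a])" "sorted_wrt (<) (map h [0..<a])"
    using assms(1,2) by (auto simp: sorted_wrt_iff_nth_less strict_mono_on_def)
  moreover have "set (map f [0..<a]) = set (map h [0..<a])"
    using assms(3) by (simp add: atLeast0LessThan)
  ultimately have "map f [0..<a] = map h [0..<a]"
    using strict_sorted_equal by blast
  then show ?thesis using \<open>j < a\<close> by (simp add: map_eq_conv)
qed

text \<open>The effect of promotion on an arm or leg with \<open>a\<close> boxes apart from the
  corner. If the first entry is 2, a dot runs through: the entries move one place towards the corner
  and the last place receives \<open>M + 1\<close>. Otherwise the entries only decrease by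
  1.\<close>

definition rotate_seq :: "nat \<Rightarrow> nat \<Rightarrow> (nat \<Rightarrow> nat) \<Rightarrow> nat \<Rightarrow> nat" where
  "rotate_seq M a f j =
     (if f 0 = 2 then if Suc j = a then M + 1 else f (Suc j) - 1 else f j - 1)"

text \<open>The reflection carries \<open>{2..M + 1}\<close> to \<open>{..<M}\<close> and turns a
  decrease by 1 into an increase by 1.\<close>

definition reflected_range :: "nat \<Rightarrow> nat \<Rightarrow> (nat \<Rightarrow> nat) \<Rightarrow> nat set" where
  "reflected_range M a f = (\<lambda>j. M + 1 - f j) ` {..<a}"

text \<open>Only the entry 2 wraps around: it reflects to \<open>M - 1\<close>, and its replacement
  \<open>M + 1\<close> reflects to 0. By monotonicity it can only stand in position 0; without it
  every entry is at least 3, and the reflected values increase without reduction modulo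
  \<open>M\<close>.\<close>

lemma
  assumes mono: "strict_mono_on {..<a} f" and ran: "f ` {..<a} \<subseteq> {2..M + 1}"
  shows rotate_seq_strict_mono: "strict_mono_on {..<a} (rotate_seq M a f)"
    and rotate_seq_range: "rotate_seq M a f ` {..<a} \<subseteq> {2..M + 1}"
    and reflected_range_rotate_seq: "reflected_range M a (rotate_seq M a f) = (\<lambda>x. (x + 1) mod M) ` reflected_range M a f"
proof -
  have lt: "f i < f j" if "i < j" "j < a" for i j
    using mono that by (auto simp: strict_mono_on_def)
  have bd: "2 \<le> f j" "f j \<le> M + 1" if "j < a" for j
    using ran that by auto
  have bd3: "3 \<le> f j" if "0 < j" "j < a" for j
    using lt[of 0 j] bd[of 0] that by auto
  have bd3': "3 \<le> f j" if "f 0 \<noteq> 2" "j < a" for j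
    using bd3[of j] bd[of j] that by (cases "j = 0") auto
  show "strict_mono_on {..<a} (rotate_seq M a f)"
  proof (rule strict_mono_onI)
    fix i j assume ij: "i \<in> {..<a}" "j \<in> {..<a}" "i < j"
    then have "f i < f j" "Suc i < a" "f (Suc i) \<le> M + 1" "3 \<le> f (Suc i)" "2 \<le> f i"
      using lt[of i j] bd[of "Suc i"] bd3[of "Suc i"] bd[of i] by auto
    moreover have "Suc j < a \<Longrightarrow> f (Suc i) < f (Suc j)"
      using lt[of "Suc i" "Suc j"] ij by auto
    ultimately show "rotate_seq M a f i < rotate_seq M a f j"
      using ij by (auto simp: rotate_seq_def)
  qed
  show "rotate_seq M a f ` {..<a} \<subseteq> {2..M + 1}"
  proof (rule image_subsetI)
    fix j assume "j \<in> {..<a}"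
    then have j: "j < a" by simp
    have M: "1 \<le> M" using bd[OF j] by simp
    show "rotate_seq M a f j \<in> {2..M + 1}"
    proof (cases "f 0 = 2")
      case True
      show ?thesis
      proof (cases "Suc j = a")
        case False
        then have "3 \<le> f (Suc j)" "f (Suc j) \<le> M + 1"
          using j bd3[of "Suc j"] bd[of "Suc j"] by auto
        then show ?thesis using True False by (auto simp: rotate_seq_def)
      qed (use True M in \<open>auto simp: rotate_seq_def\<close>)
    next
      case False
      then show ?thesis using bd3'[OF False j] bd[OF j] by (auto simp: rotate_seq_def)
    qed
  qed
  show "reflected_range M a (rotate_seq M a f) = (\<lambda>x. (x + 1) mod M) ` reflected_range M a f"
  proof (cases "f 0 = 2")
    case False
    have "M + 1 - rotate_seq M a f j = (M + 1 - f j + 1) mod M" if "j < a" for j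
    proof -
      have "M + 1 - (f j - 1) = M + 1 - f j + 1" "M + 1 - f j + 1 < M"
        using bd3'[OF False that] bd[OF that] by auto
      then show ?thesis using False by (simp add: rotate_seq_def)
    qed
    then show ?thesis by (auto simp: reflected_range_def image_image)
  next
    case True
    show ?thesis
    proof (cases a)
      case 0
      then show ?thesis by (simp add: reflected_range_def)
    next
      case (Suc b)
      have M: "1 \<le> M" using bd[of 0] Suc by simp
      have step: "M + 1 - rotate_seq M a f j = (M + 1 - f (Suc j) + 1) mod M" if "j < b" for j
      proof -
        have "3 \<le> f (Suc j)" "f (Suc j) \<le> M + 1"
          using bd3[of "Suc j"] bd[of "Suc j"] that Suc by auto
        then have "M + 1 - (f (Suc j) - 1) = M + 1 - f (Suc j) + 1" "M + 1 - f (Suc j) + 1 < M"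
          by auto
        then show ?thesis using True Suc that by (simp add: rotate_seq_def)
      qed
      \<comment> \<open>The last position \<open>b\<close> takes up the shifted value of position 0,
        and each \<open>j < b\<close> that of position \<open>Suc j\<close>; as sets, the two sides
        agree.\<close>
      have "reflected_range M a (rotate_seq M a f)
          = insert (M + 1 - rotate_seq M a f b) ((\<lambda>j. M + 1 - rotate_seq M a f j) ` {..<b})"
        by (simp add: reflected_range_def Suc lessThan_Suc)
      also have "M + 1 - rotate_seq M a f b = (M + 1 - f 0 + 1) mod M"
        using True Suc M by (simp add: rotate_seq_def)
      also have "(\<lambda>j. M + 1 - rotate_seq M a f j) ` {..<b} = (\<lambda>j. (M + 1 - f (Suc j) + 1) mod M) ` {..<b}"
        by (rule image_cong) (simp_all only: step lessThan_iff)
      also have "insert ((M + 1 - f 0 + 1) mod M) \<dots> = (\<lambda>x. (x + 1) mod M) ` reflected_range M a f"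
        by (simp only: reflected_range_def Suc lessThan_Suc_eq_insert_0 image_insert image_image)
      finally show ?thesis .
    qed
  qed
qed

lemma reflected_range_inj:
  assumes "strict_mono_on {..<a} f" "f ` {..<a} \<subseteq> {2..M + 1}"
    and "strict_mono_on {..<a} h" "h ` {..<a} \<subseteq> {2..M + 1}"
    and "reflected_range M a f = reflected_range M a h" "j < a"
  shows "f j = h j"
proof -
  \<comment> \<open>The reflection is its own inverse on \<open>{2..M + 1}\<close>, so the range of
    \<open>f\<close> is recovered.\<close>
  have dec: "f ` {..<a} = (\<lambda>x. M + 1 - x) ` reflected_range M a f" if "f ` {..<a} \<subseteq> {2..M + 1}" for f
  proof -
    have "(\<lambda>x. M + 1 - x) ` reflected_range M a f = (\<lambda>j. M + 1 - (M + 1 - f j)) ` {..<a}"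
      by (simp add: reflected_range_def image_image)
    also have "\<dots> = f ` {..<a}"
      using that by (intro image_cong) auto
    finally show ?thesis by simp
  qed
  show ?thesis
    using strict_mono_on_lessThan_unique[of a f h j] dec assms by metis
qed

lemma card_reflected_range:
  assumes "strict_mono_on {..<a} f" "f ` {..<a} \<subseteq> {2..M + 1}"
  shows "card (reflected_range M a f) = a"
proof -
  have "inj_on (\<lambda>j. M + 1 - f j) {..<a}"
  proof (rule inj_onI)
    fix i j assume ij: "i \<in> {..<a}" "j \<in> {..<a}" "M + 1 - f i = M + 1 - f j"
    then have "f i \<le> M + 1" "f j \<le> M + 1" using assms(2) by auto
    then have "f i = f j" using ij by auto
    then show "i = j"
      using strict_mono_on_imp_inj_on[OF assms(1)] ij by (auto dest: inj_onD)
  qed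
  then show ?thesis by (simp add: reflected_range_def card_image)
qed

lemma reflected_range_cover_iff:
  assumes "f ` {..<a} \<subseteq> {2..M + 1}" "h ` {..<b} \<subseteq> {2..M + 1}"
  shows "reflected_range M a f \<union> reflected_range M b h = {..<M} \<longleftrightarrow> f ` {..<a} \<union> h ` {..<b} = {2..M + 1}"
proof -
  have inj: "inj_on (\<lambda>x. M + 1 - x) {2..M + 1}"
    by (auto intro!: inj_onI)
  have im: "(\<lambda>x. M + 1 - x) ` {2..M + 1} = {..<M}"
  proof
    show "{..<M} \<subseteq> (\<lambda>x. M + 1 - x) ` {2..M + 1}"
    proof
      fix y assume "y \<in> {..<M}"
      then show "y \<in> (\<lambda>x. M + 1 - x) ` {2..M + 1}"
        by (intro image_eqI[of _ _ "M + 1 - y"]) auto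
    qed
  qed auto
  have "reflected_range M a f \<union> reflected_range M b h = (\<lambda>x. M + 1 - x) ` (f ` {..<a} \<union> h ` {..<b})"
    by (simp add: reflected_range_def image_image image_Un)
  then show ?thesis
    using inj_on_image_eq_iff[OF inj, of "f ` {..<a} \<union> h ` {..<b}" "{2..M + 1}"] assms im by auto
qed

lemma ex_reflected_range:
  assumes "S \<subseteq> {..<M}" "card S = a"
  obtains f where "strict_mono_on {..<a} f" "f ` {..<a} \<subseteq> {2..M + 1}" "reflected_range M a f = S"
proof -
  have fin: "finite S" using assms(1) finite_subset by blast
  define S' where "S' = (\<lambda>x. M + 1 - x) ` S"
  have "inj_on (\<lambda>x. M + 1 - x) S"
    using assms(1) by (auto intro!: inj_onI)
  then have "card S' = a" using assms(2) by (simp add: S'_def card_image)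
  moreover have "finite S'" using fin by (simp add: S'_def)
  ultimately obtain f where f: "strict_mono_on {..<a} f" "f ` {..<a} = S'"
    using ex_bij_betw_strict_mono_card[of S'] by (metis bij_betw_imp_surj_on)
  have "reflected_range M a f = (\<lambda>x. M + 1 - x) ` f ` {..<a}"
    by (simp add: reflected_range_def image_image)
  also have "\<dots> = (\<lambda>x. M + 1 - (M + 1 - x)) ` S"
    by (simp add: f(2) S'_def image_image)
  also have "\<dots> = id ` S"
    using assms(1) by (intro image_cong) auto
  finally have "reflected_range M a f = S" by simp
  moreover have "f ` {..<a} \<subseteq> {2..M + 1}"
    unfolding f(2) S'_def using assms(1) by auto
  ultimately show thesis using that f(1) by blast
qed

subsection \<open>Promotion of hook tableaux\<close>

text \<open>\<open>l\<close> only witnesses termination; the loop may stop at an earlier iterate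
  \<open>m\<close>, of which just the failing test is recorded.\<close>

lemma while_eq_funpow:
  assumes "\<not> b ((c ^^ l) s)"
  obtains m where "while b c s = (c ^^ m) s" "\<not> b ((c ^^ m) s)"
proof -
  have "\<exists>t. while_option b c s = Some t"
    using assms by (auto simp: while_option_def)
  then show thesis
    using that while_option_stop2[of b c s] by (metis option.sel while_def)
qed

lemma move_dots_eqI:
  assumes "{p \<in> D. \<not> movable Z p}
        \<union> {(i, j + 1) | i j. (i, j) \<in> D \<and> moves_right Z U (i, j)}
        \<union> {(i + 1, j) | i j. (i, j) \<in> D \<and> moves_down Z U (i, j)} = D'"
    and "\<And>i j. (if (i, j) \<in> D \<and> moves_right Z U (i, j) then U (i, j + 1)
        else if (i, j) \<in> D \<and> moves_down Z U (i, j) then U (i + 1, j)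
        else U (i, j)) = U' (i, j)"
  shows "move_dots Z (D, U) = (D', U')"
  using assms by (auto simp only: move_dots_def prod.case prod.inject fun_eq_iff split_paired_all)

text \<open>\<open>M\<close> is the order of the cyclic group and \<open>M + 1\<close> the largest
  entry; the additive equation avoids truncated subtraction. By \<open>0 < M\<close> the entry 2
  occurs, so the dot can always leave the corner.\<close>

locale hook_tableaux =
  fixes N r k M :: nat
  assumes N_eq: "N = M + k + 1" and r_less: "r < N" and k_le: "k \<le> r" and M_pos: "0 < M"
begin

definition arm_length :: nat where
  "arm_length = N - r - 1"

abbreviation Y :: "box set" where
  "Y \<equiv> young_diagram (hook N r)"

abbreviation X :: "(box \<Rightarrow> nat) set" where
  "X \<equiv> Inc k (hook N r)"

text \<open>The corner is excluded and positions count from 0: position 0 is box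
  \<open>(1, 2)\<close>, and for \<open>leg\<close> it is box \<open>(2, 1)\<close>.\<close>

definition arm :: "(box \<Rightarrow> nat) \<Rightarrow> nat \<Rightarrow> nat" where
  "arm T j = T (1, j + 2)"

definition leg :: "(box \<Rightarrow> nat) \<Rightarrow> nat \<Rightarrow> nat" where
  "leg T i = T (i + 2, 1)"

lemma arm_length_eq: "N = arm_length + r + 1"
  using r_less by (simp add: arm_length_def)

lemma mem_Y: "(i, j) \<in> Y \<longleftrightarrow> i = 1 \<and> 1 \<le> j \<and> j \<le> arm_length + 1 \<or> j = 1 \<and> 1 \<le> i \<and> i \<le> r + 1"
proof (cases "i = 0")
  case False
  then obtain i' where "i = Suc i'" by (cases i) auto
  then show ?thesis
    using arm_length_eq by (auto simp: young_diagram_def hook_def nth_Cons split: nat.splits)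
qed (auto simp: young_diagram_def)

lemma Y_eq: "Y = insert (1, 1) ((\<lambda>j. (1, j + 2)) ` {..<arm_length} \<union> (\<lambda>i. (i + 2, 1)) ` {..<r})"
proof (intro equalityI subrelI)
  fix i j assume "(i, j) \<in> Y"
  then consider "i = 1" "j = 1" | "i = 1" "2 \<le> j" "j - 2 < arm_length" | "j = 1" "2 \<le> i" "i - 2 < r"
    unfolding mem_Y by fastforce
  then show "(i, j) \<in> insert (1, 1) ((\<lambda>j. (1, j + 2)) ` {..<arm_length} \<union> (\<lambda>i. (i + 2, 1)) ` {..<r})"
    by cases (auto intro: image_eqI[of _ _ "j - 2"] image_eqI[of _ _ "i - 2"])
qed (auto simp: mem_Y)

lemma image_Y: "T ` Y = insert (T (1, 1)) (arm T ` {..<arm_length} \<union> leg T ` {..<r})"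
  by (simp add: Y_eq image_Un image_image arm_def leg_def)

lemma sum_list_hook: "sum_list (hook N r) = N"
  using r_less by (simp add: hook_def sum_list_replicate)

text \<open>Only the first row and the first column can have more than one box. So the corner is the
  least entry, hence 1, and arm and leg are linked only by jointly using all of
  \<open>{2..M + 1}\<close>.\<close>

lemma Inc_hook_iff:
  "T \<in> X \<longleftrightarrow> T \<in> extensional Y \<and> T (1, 1) = 1 \<and>
     strict_mono_on {..<arm_length} (arm T) \<and> strict_mono_on {..<r} (leg T) \<and>
     arm T ` {..<arm_length} \<union> leg T ` {..<r} = {2..M + 1}"
proof
  assume "T \<in> X"
  then have ext: "T \<in> extensional Y" and pos: "\<And>p. p \<in> Y \<Longrightarrow> 1 \<le> T p"
    and row: "\<And>i j j'. (i, j) \<in> Y \<Longrightarrow> (i, j') \<in> Y \<Longrightarrow> j < j' \<Longrightarrow> T (i, j) < T (i, j')"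
    and col: "\<And>i i' j. (i, j) \<in> Y \<Longrightarrow> (i', j) \<in> Y \<Longrightarrow> i < i' \<Longrightarrow> T (i, j) < T (i', j)"
    and full: "\<And>m. 1 \<le> m \<Longrightarrow> m \<le> Max (T ` Y) \<Longrightarrow> m \<in> T ` Y"
    and "Max (T ` Y) + k = N"
    by (auto simp: Inc_def increasing_tableau_def sum_list_hook)
  then have max: "Max (T ` Y) = M + 1" using N_eq by simp
  have fin: "finite (T ` Y)" by (simp add: Y_eq)
  have arm: "strict_mono_on {..<arm_length} (arm T)"
    by (auto intro!: strict_mono_onI row simp: arm_def mem_Y)
  have leg: "strict_mono_on {..<r} (leg T)"
    by (auto intro!: strict_mono_onI col simp: leg_def mem_Y)
  have gt: "T (1, 1) < x" if "x \<in> arm T ` {..<arm_length} \<union> leg T ` {..<r}" for x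
    using that by (auto intro!: row col simp: arm_def leg_def mem_Y)
  have "(1, 1) \<in> Y" by (simp add: mem_Y)
  then have "1 \<le> T (1, 1)" using pos by blast
  moreover have "1 \<in> T ` Y" using full[of 1] max by simp
  ultimately have one: "T (1, 1) = 1"
    unfolding image_Y using gt[of 1] by auto
  have "T ` Y = {1..M + 1}"
  proof (intro equalityI subsetI)
    fix x assume x: "x \<in> T ` Y"
    then have "1 \<le> x" using pos by auto
    then show "x \<in> {1..M + 1}" using Max_ge[OF fin x] max by simp
  qed (use full max in auto)
  then have "insert 1 (arm T ` {..<arm_length} \<union> leg T ` {..<r}) = {1..M + 1}"
    by (simp only: image_Y one)
  moreover have "1 \<notin> arm T ` {..<arm_length} \<union> leg T ` {..<r}"
    using gt[of 1] one by auto
  ultimately have "arm T ` {..<arm_length} \<union> leg T ` {..<r} = {1..M + 1} - {1}"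
    by blast
  also have "\<dots> = {2..M + 1}" by auto
  finally show "T \<in> extensional Y \<and> T (1, 1) = 1 \<and>
     strict_mono_on {..<arm_length} (arm T) \<and> strict_mono_on {..<r} (leg T) \<and>
     arm T ` {..<arm_length} \<union> leg T ` {..<r} = {2..M + 1}"
    using ext one arm leg by blast
next
  assume R: "T \<in> extensional Y \<and> T (1, 1) = 1 \<and>
     strict_mono_on {..<arm_length} (arm T) \<and> strict_mono_on {..<r} (leg T) \<and>
     arm T ` {..<arm_length} \<union> leg T ` {..<r} = {2..M + 1}"
  have im: "T ` Y = {1..M + 1}"
    unfolding image_Y using R by auto
  have max: "Max (T ` Y) = M + 1"
    unfolding im by (rule Max_eqI) auto
  have arm_mono: "T (1, j) < T (1, j')" if "2 \<le> j" "j < j'" "j' \<le> arm_length + 1" for j j'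
  proof -
    have "arm T (j - 2) < arm T (j' - 2)"
      using R that by (intro strict_mono_onD[of "{..<arm_length}" "arm T"]) auto
    moreover have "j - 2 + 2 = j" "j' - 2 + 2 = j'" using that by auto
    ultimately show ?thesis by (simp only: arm_def)
  qed
  have leg_mono: "T (i, 1) < T (i', 1)" if "2 \<le> i" "i < i'" "i' \<le> r + 1" for i i'
  proof -
    have "leg T (i - 2) < leg T (i' - 2)"
      using R that by (intro strict_mono_onD[of "{..<r}" "leg T"]) auto
    moreover have "i - 2 + 2 = i" "i' - 2 + 2 = i'" using that by auto
    ultimately show ?thesis by (simp only: leg_def)
  qed
  have arm_gt: "1 < T (1, j)" if "2 \<le> j" "j \<le> arm_length + 1" for j
  proof -
    have "arm T (j - 2) \<in> {2..M + 1}" using R that by auto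
    moreover have "j - 2 + 2 = j" using that by auto
    ultimately show ?thesis by (simp only: arm_def) simp
  qed
  have leg_gt: "1 < T (i, 1)" if "2 \<le> i" "i \<le> r + 1" for i
  proof -
    have "leg T (i - 2) \<in> {2..M + 1}" using R that by auto
    moreover have "i - 2 + 2 = i" using that by auto
    ultimately show ?thesis by (simp only: leg_def) simp
  qed
  have row: "T (i, j) < T (i, j')" if "(i, j) \<in> Y" "(i, j') \<in> Y" "j < j'" for i j j'
  proof -
    have "i = 1" "j' \<le> arm_length + 1" "1 \<le> j" using that by (auto simp: mem_Y)
    then show ?thesis
      using that R arm_mono[of j j'] arm_gt[of j'] by (cases "j = 1") auto
  qed
  have col: "T (i, j) < T (i', j)" if "(i, j) \<in> Y" "(i', j) \<in> Y" "i < i'" for i i' j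
  proof -
    have "j = 1" "i' \<le> r + 1" "1 \<le> i" using that by (auto simp: mem_Y)
    then show ?thesis
      using that R leg_mono[of i i'] leg_gt[of i'] by (cases "i = 1") auto
  qed
  have "\<forall>p\<in>Y. 1 \<le> T p" using im by auto
  then show "T \<in> X"
    using R row col im N_eq
    unfolding Inc_def increasing_tableau_def sum_list_hook mem_Collect_eq max by auto
qed

text \<open>Past the corner a dot has no lower neighbour, so its moves do not depend on the entries
  \<open>U\<close>.\<close>

lemma moves_on_arm:
  assumes "2 \<le> c"
  shows "moves_right Y U (1, c) \<longleftrightarrow> c \<le> arm_length" "\<not> moves_down Y U (1, c)"
    "movable Y (1, c) \<longleftrightarrow> c \<le> arm_length"
  using assms by (auto simp: moves_right_def moves_down_def movable_def mem_Y)

lemma moves_on_leg: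
  assumes "2 \<le> c"
  shows "\<not> moves_right Y U (c, 1)" "moves_down Y U (c, 1) \<longleftrightarrow> c \<le> r"
    "movable Y (c, 1) \<longleftrightarrow> c \<le> r"
  using assms by (auto simp: moves_right_def moves_down_def movable_def mem_Y)

text \<open>As 2 is the least entry outside the corner, this says that the corner dot enters the
  arm. It can hold together with \<open>leg_moves\<close>; the dot then splits.\<close>

definition arm_moves :: "(box \<Rightarrow> nat) \<Rightarrow> bool" where
  "arm_moves T \<longleftrightarrow> 0 < arm_length \<and> T (1, 2) = 2"

definition leg_moves :: "(box \<Rightarrow> nat) \<Rightarrow> bool" where
  "leg_moves T \<longleftrightarrow> 0 < r \<and> T (2, 1) = 2"

text \<open>The state after \<open>s\<close> moves, in closed form; \<open>min\<close> keeps a dot that has arrived at the end of the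
  arm or leg in place.\<close>

definition sliding_dots :: "(box \<Rightarrow> nat) \<Rightarrow> nat \<Rightarrow> box set" where
  "sliding_dots T s = (if arm_moves T then {(1, min s arm_length + 1)} else {})
     \<union> (if leg_moves T then {(min s r + 1, 1)} else {})"

definition sliding_entries :: "(box \<Rightarrow> nat) \<Rightarrow> nat \<Rightarrow> box \<Rightarrow> nat" where
  "sliding_entries T s = (\<lambda>(i, j).
     if i = 1 \<and> j = 1 then (if s = 0 then T (1, 1) else 2)
     else if arm_moves T \<and> i = 1 \<and> 2 \<le> j \<and> j \<le> min s arm_length then T (1, j + 1)
     else if leg_moves T \<and> j = 1 \<and> 2 \<le> i \<and> i \<le> min s r then T (i + 1, 1)
     else T (i, j))"

lemma
  assumes "T \<in> X"
  shows arm_or_leg_moves: "arm_moves T \<or> leg_moves T"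
    and moves_right_corner: "moves_right Y T (1, 1) \<longleftrightarrow> arm_moves T"
    and moves_down_corner: "moves_down Y T (1, 1) \<longleftrightarrow> leg_moves T"
proof -
  have arm: "strict_mono_on {..<arm_length} (arm T)" and leg: "strict_mono_on {..<r} (leg T)"
    and im: "arm T ` {..<arm_length} \<union> leg T ` {..<r} = {2..M + 1}"
    using assms by (simp_all add: Inc_hook_iff)
  have arm0: "2 \<le> T (1, 2)" if "0 < arm_length"
  proof -
    have "arm T 0 \<in> {2..M + 1}" using im that by auto
    then show ?thesis by (simp add: arm_def numeral_2_eq_2)
  qed
  have leg0: "2 \<le> T (2, 1)" if "0 < r"
  proof -
    have "leg T 0 \<in> {2..M + 1}" using im that by auto
    then show ?thesis by (simp add: leg_def numeral_2_eq_2)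
  qed
  \<comment> \<open>\<open>0 < M\<close> puts 2 among the entries, and monotonicity places it first
    in its branch.\<close>
  have "2 \<in> arm T ` {..<arm_length} \<union> leg T ` {..<r}"
    using M_pos by (simp add: im)
  then show or: "arm_moves T \<or> leg_moves T"
  proof
    assume "2 \<in> arm T ` {..<arm_length}"
    then obtain j where j: "j < arm_length" "arm T j = 2" by auto
    have "arm T 0 \<le> arm T j"
      using strict_mono_onD[OF arm, of 0 j] j by (cases "j = 0") auto
    then show ?thesis using j arm0 by (auto simp: arm_moves_def arm_def numeral_2_eq_2)
  next
    assume "2 \<in> leg T ` {..<r}"
    then obtain j where j: "j < r" "leg T j = 2" by auto
    have "leg T 0 \<le> leg T j"
      using strict_mono_onD[OF leg, of 0 j] j by (cases "j = 0") auto
    then show ?thesis using j leg0 by (auto simp: leg_moves_def leg_def numeral_2_eq_2)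
  qed
  \<comment> \<open>One neighbour of the corner is 2 and the other, if present, is at least 2, so
    comparing them amounts to asking where 2 stands.\<close>
  show "moves_right Y T (1, 1) \<longleftrightarrow> arm_moves T"
    using or arm0 leg0
    by (auto simp: moves_right_def mem_Y arm_moves_def leg_moves_def numeral_2_eq_2)
  show "moves_down Y T (1, 1) \<longleftrightarrow> leg_moves T"
    using or arm0 leg0
    by (auto simp: moves_down_def mem_Y arm_moves_def leg_moves_def numeral_2_eq_2)
qed

lemma movable_corner: "T \<in> X \<Longrightarrow> movable Y (1, 1)"
  using arm_or_leg_moves[of T] by (auto simp: movable_def mem_Y arm_moves_def leg_moves_def)

lemma sliding_dots_0: "T \<in> X \<Longrightarrow> sliding_dots T 0 = {(1, 1)}"
  using arm_or_leg_moves[of T] by (auto simp: sliding_dots_def)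

lemma sliding_entries_0: "sliding_entries T 0 = T"
  by (auto simp: sliding_entries_def fun_eq_iff)

text \<open>Whether the dot moves right, down or both ways, the entry moving into the corner is
  2.\<close>

lemma move_dots_sliding_0:
  assumes "T \<in> X"
  shows "move_dots Y ({(1, 1)}, T) = (sliding_dots T (Suc 0), sliding_entries T (Suc 0))"
proof (rule move_dots_eqI)
  show "{p \<in> {(1, 1)}. \<not> movable Y p}
        \<union> {(i, j + 1) | i j. (i, j) \<in> {(1, 1)} \<and> moves_right Y T (i, j)}
        \<union> {(i + 1, j) | i j. (i, j) \<in> {(1, 1)} \<and> moves_down Y T (i, j)}
      = sliding_dots T (Suc 0)"
    using movable_corner[OF assms] moves_right_corner[OF assms] moves_down_corner[OF assms]
    by (auto simp: sliding_dots_def arm_moves_def leg_moves_def)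
  show "(if (i, j) \<in> {(1, 1)} \<and> moves_right Y T (i, j) then T (i, j + 1)
        else if (i, j) \<in> {(1, 1)} \<and> moves_down Y T (i, j) then T (i + 1, j)
        else T (i, j)) = sliding_entries T (Suc 0) (i, j)" for i j
    using moves_right_corner[OF assms] moves_down_corner[OF assms] arm_or_leg_moves[OF assms]
    by (auto simp: sliding_entries_def arm_moves_def leg_moves_def numeral_2_eq_2)
qed

text \<open>After the first move each dot stays in its own branch and advances box by box. A box
  that a dot enters keeps its former value both in \<open>move_dots\<close> and in the closed form,
  so the entries agree as functions, on the dots too.\<close>

lemma move_dots_sliding_Suc:
  assumes "1 \<le> s"
  shows "move_dots Y (sliding_dots T s, sliding_entries T s)
    = (sliding_dots T (Suc s), sliding_entries T (Suc s))"
proof (rule move_dots_eqI)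
  let ?D = "sliding_dots T s" and ?U = "sliding_entries T s"
  have c: "arm_moves T \<Longrightarrow> 2 \<le> min s arm_length + 1" "leg_moves T \<Longrightarrow> 2 \<le> min s r + 1"
    using assms by (auto simp: arm_moves_def leg_moves_def)
  have right: "(i, j) \<in> ?D \<and> moves_right Y ?U (i, j) \<longleftrightarrow>
      arm_moves T \<and> i = 1 \<and> j = s + 1 \<and> s < arm_length" for i j
    using moves_on_arm(1)[OF c(1), of ?U] moves_on_leg(1)[OF c(2), of ?U]
    by (auto simp: sliding_dots_def)
  have down: "(i, j) \<in> ?D \<and> moves_down Y ?U (i, j) \<longleftrightarrow>
      leg_moves T \<and> j = 1 \<and> i = s + 1 \<and> s < r" for i j
    using moves_on_arm(2)[OF c(1), of ?U] moves_on_leg(2)[OF c(2), of ?U]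
    by (auto simp: sliding_dots_def)
  have stay: "{p \<in> ?D. \<not> movable Y p} =
      {p. arm_moves T \<and> arm_length \<le> s \<and> p = (1, arm_length + 1) \<or>
          leg_moves T \<and> r \<le> s \<and> p = (r + 1, 1)}"
    using moves_on_arm(3)[OF c(1)] moves_on_leg(3)[OF c(2)]
    by (auto simp: sliding_dots_def)
  show "{p \<in> ?D. \<not> movable Y p}
        \<union> {(i, j + 1) | i j. (i, j) \<in> ?D \<and> moves_right Y ?U (i, j)}
        \<union> {(i + 1, j) | i j. (i, j) \<in> ?D \<and> moves_down Y ?U (i, j)}
      = sliding_dots T (Suc s)"
    unfolding stay right down by (auto simp: sliding_dots_def min_def)
  show "(if (i, j) \<in> ?D \<and> moves_right Y ?U (i, j) then ?U (i, j + 1)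
        else if (i, j) \<in> ?D \<and> moves_down Y ?U (i, j) then ?U (i + 1, j)
        else ?U (i, j)) = sliding_entries T (Suc s) (i, j)" for i j
    unfolding right down using assms by (auto simp: sliding_entries_def le_Suc_eq)
qed

text \<open>The exact number of moves can be left open: the closed form no longer changes once every
  dot has reached the end of its branch.\<close>

lemma slide_dots_eq:
  assumes "T \<in> X"
  obtains s where "slide_dots Y T = (sliding_dots T s, sliding_entries T s)" "1 \<le> s"
    "arm_moves T \<Longrightarrow> arm_length \<le> s" "leg_moves T \<Longrightarrow> r \<le> s"
proof -
  let ?b = "\<lambda>(D, T). \<exists>p \<in> D. movable Y p"
  have step: "move_dots Y (sliding_dots T s, sliding_entries T s)
      = (sliding_dots T (Suc s), sliding_entries T (Suc s))" for s
    using move_dots_sliding_0[OF assms] move_dots_sliding_Suc[of s T]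
    by (cases "s = 0") (simp_all add: sliding_dots_0[OF assms] sliding_entries_0)
  have pow: "(move_dots Y ^^ s) ({(1, 1)}, T) = (sliding_dots T s, sliding_entries T s)" for s
    by (induction s) (simp_all add: step sliding_dots_0[OF assms] sliding_entries_0)
  have stop: "?b (sliding_dots T s, sliding_entries T s) \<longleftrightarrow>
      \<not> (1 \<le> s \<and> (arm_moves T \<longrightarrow> arm_length \<le> s) \<and> (leg_moves T \<longrightarrow> r \<le> s))" for s
  proof (cases "s = 0")
    case True
    then show ?thesis
      using movable_corner[OF assms] by (simp add: sliding_dots_0[OF assms])
  next
    case False
    have "arm_moves T \<Longrightarrow> 2 \<le> min s arm_length + 1" "leg_moves T \<Longrightarrow> 2 \<le> min s r + 1"
      using False by (auto simp: arm_moves_def leg_moves_def)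
    then show ?thesis
      using moves_on_arm(3)[of "min s arm_length + 1"] moves_on_leg(3)[of "min s r + 1"] False
      by (auto simp: sliding_dots_def)
  qed
  \<comment> \<open>\<open>arm_length + r + 1\<close> is positive and exceeds the length of either
    branch, so this iterate witnesses termination.\<close>
  have "\<not> ?b ((move_dots Y ^^ (arm_length + r + 1)) ({(1, 1)}, T))"
    unfolding pow stop by simp
  then obtain m where "slide_dots Y T = (move_dots Y ^^ m) ({(1, 1)}, T)"
      "\<not> ?b ((move_dots Y ^^ m) ({(1, 1)}, T))"
    unfolding slide_dots_def by (rule while_eq_funpow)
  then show thesis
    using that[of m] unfolding pow stop by blast
qed

text \<open>A branch entered by a dot has moved one box towards the corner and ends in the dot,
  which becomes \<open>M + 1\<close>; the other branch is only decreased. The test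
  \<open>f 0 = 2\<close> of \<open>rotate_seq\<close> is \<open>arm_moves\<close> or
  \<open>leg_moves\<close>.\<close>

lemma K_promotion_hook:
  assumes "T \<in> X"
  shows "K_promotion (hook N r) T (1, 1) = 1"
    and "j < arm_length \<Longrightarrow> arm (K_promotion (hook N r) T) j = rotate_seq M arm_length (arm T) j"
    and "j < r \<Longrightarrow> leg (K_promotion (hook N r) T) j = rotate_seq M r (leg T) j"
proof -
  obtain s where s: "slide_dots Y T = (sliding_dots T s, sliding_entries T s)" "1 \<le> s"
    "arm_moves T \<Longrightarrow> arm_length \<le> s" "leg_moves T \<Longrightarrow> r \<le> s"
    using slide_dots_eq[OF assms] by blast
  have im: "T ` Y = {1..M + 1}"
    using assms unfolding Inc_hook_iff image_Y by auto
  have max: "Max (T ` Y) = M + 1"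
    unfolding im by (rule Max_eqI) auto
  have K: "K_promotion (hook N r) T p = (if p \<in> sliding_dots T s then M + 1 else sliding_entries T s p - 1)"
    if "p \<in> Y" for p
    using that by (simp add: K_promotion_def Let_def s(1) max)
  \<comment> \<open>After at least one move the corner holds 2, which the final decrease turns into
    1.\<close>
  show "K_promotion (hook N r) T (1, 1) = 1"
    using s(2-4) by (subst K) (auto simp: mem_Y sliding_dots_def sliding_entries_def arm_moves_def leg_moves_def)
  show "arm (K_promotion (hook N r) T) j = rotate_seq M arm_length (arm T) j" if "j < arm_length"
  proof -
    have corner: "arm T 0 = 2 \<longleftrightarrow> arm_moves T"
      using that by (auto simp: arm_def arm_moves_def numeral_2_eq_2)
    have dots: "(1, j + 2) \<in> sliding_dots T s \<longleftrightarrow> arm_moves T \<and> Suc j = arm_length"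
      using that s(3) by (auto simp: sliding_dots_def)
    have entry: "sliding_entries T s (1, j + 2) =
        (if arm_moves T \<and> Suc j \<noteq> arm_length then arm T (Suc j) else arm T j)"
      using that s(3) by (auto simp: sliding_entries_def arm_def)
    have "(1, j + 2) \<in> Y" using that by (simp add: mem_Y)
    then have "arm (K_promotion (hook N r) T) j =
        (if arm_moves T \<and> Suc j = arm_length then M + 1
         else (if arm_moves T \<and> Suc j \<noteq> arm_length then arm T (Suc j) else arm T j) - 1)"
      by (simp only: arm_def[of "K_promotion (hook N r) T"] K dots entry)
    then show ?thesis by (simp add: rotate_seq_def corner)
  qed
  show "leg (K_promotion (hook N r) T) j = rotate_seq M r (leg T) j" if "j < r"
  proof -
    have corner: "leg T 0 = 2 \<longleftrightarrow> leg_moves T"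
      using that by (auto simp: leg_def leg_moves_def numeral_2_eq_2)
    have dots: "(j + 2, 1) \<in> sliding_dots T s \<longleftrightarrow> leg_moves T \<and> Suc j = r"
      using that s(4) by (auto simp: sliding_dots_def)
    have entry: "sliding_entries T s (j + 2, 1) =
        (if leg_moves T \<and> Suc j \<noteq> r then leg T (Suc j) else leg T j)"
      using that s(4) by (auto simp: sliding_entries_def leg_def)
    have "(j + 2, 1) \<in> Y" using that by (simp add: mem_Y)
    then have "leg (K_promotion (hook N r) T) j =
        (if leg_moves T \<and> Suc j = r then M + 1
         else (if leg_moves T \<and> Suc j \<noteq> r then leg T (Suc j) else leg T j) - 1)"
      by (simp only: leg_def[of "K_promotion (hook N r) T"] K dots entry)
    then show ?thesis by (simp add: rotate_seq_def corner)
  qed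
qed

end

subsection \<open>Cyclic sieving for hook tableaux\<close>

lemma funpow_mod_period:
  assumes per: "\<And>x. x \<in> S \<Longrightarrow> (f ^^ M) x = x" and "x \<in> S"
  shows "(f ^^ n) x = (f ^^ (n mod M)) x"
proof -
  have "(f ^^ (M * q)) x = x" for q
  proof (induction q)
    case (Suc q)
    then show ?case using per[OF \<open>x \<in> S\<close>] by (simp add: funpow_add)
  qed simp
  then show ?thesis
    using funpow_add[of "n mod M" "M * (n div M)" f] by (simp add: add.commute)
qed

text \<open>\<open>g [^] n\<close> is to act as \<open>f ^^ n\<close>. This is well defined because
  \<open>g\<close> has order \<open>M\<close> and \<open>f ^^ M\<close> is the identity on
  \<open>S\<close>; the action need not be faithful.\<close>

lemma cyclic_group_action:
  fixes C :: "('g, 'm) monoid_scheme" (structure)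
  assumes C: "group C" "finite (carrier C)" and M: "card (carrier C) = M"
    and g: "g \<in> carrier C" and gen: "subgroup_generated C {g} = C"
    and cl: "\<And>x. x \<in> S \<Longrightarrow> f x \<in> S" and per: "\<And>x. x \<in> S \<Longrightarrow> (f ^^ M) x = x"
  obtains \<phi> where "group_action C S \<phi>" "\<And>d. \<phi> (g [^] (d::nat)) = restrict (f ^^ d) S"
proof -
  interpret group C by (rule C)
  have carrier: "carrier C = generate C {g}"
    using carrier_subgroup_generated[of C "{g}"] gen g by simp
  have ord: "ord g = M"
    using generate_pow_card[OF g] carrier M by simp
  have M0: "0 < M" using M C g by (auto simp: card_gt_0_iff)
  have ex: "\<exists>n::nat. g [^] n = h" if "h \<in> carrier C" for h
    using that carrier generate_pow_on_finite_carrier[OF C(2) g] by auto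
  have eq: "restrict (f ^^ n) S = restrict (f ^^ m) S" if "g [^] n = g [^] m" for n m :: nat
  proof -
    have "int M dvd int m - int n"
      using that int_pow_eq[OF g, of "int n" "int m"] by (simp add: int_pow_int ord)
    then have "n mod M = m mod M"
      by (metis mod_eq_dvd_iff of_nat_eq_iff of_nat_mod)
    then have "(f ^^ n) x = (f ^^ m) x" if "x \<in> S" for x
      using funpow_mod_period[OF per that] by metis
    then show ?thesis by (auto simp: restrict_def)
  qed
  \<comment> \<open>Some exponent representing \<open>h\<close> is chosen; by \<open>eq\<close> the
    choice does not matter. The restriction is needed because elements of \<open>BijGroup S\<close>
    are extensional.\<close>
  define \<phi> where "\<phi> h = restrict (f ^^ (SOME n. g [^] (n::nat) = h)) S" for h
  have \<phi>: "\<phi> (g [^] d) = restrict (f ^^ d) S" for d :: nat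
    unfolding \<phi>_def by (rule eq) (rule someI_ex, blast)
  have clp: "(f ^^ n) x \<in> S" if "x \<in> S" for n x
    using that by (induction n) (auto intro: cl)
  have inv: "(f ^^ n) ((f ^^ m) x) = x" if "M dvd n + m" "x \<in> S" for n m x
    using funpow_mod_period[OF per that(2), of "n + m"] that(1)
    by (simp add: funpow_add)
  have Bij: "restrict (f ^^ n) S \<in> Bij S" for n
  proof -
    \<comment> \<open>The exponents \<open>n\<close> and \<open>(M - 1) * n\<close> add up to
      \<open>M * n\<close>, so the second power inverts the first on \<open>S\<close>.\<close>
    have "M dvd n + (M - 1) * n" "M dvd (M - 1) * n + n"
      using M0 by (auto simp: algebra_simps)
    then have "bij_betw (f ^^ n) S S"
      using clp inv by (intro bij_betw_byWitness[where f' = "f ^^ ((M - 1) * n)"]) auto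
    then show ?thesis
      by (simp add: Bij_def)
  qed
  have "\<phi> \<in> hom C (BijGroup S)"
  proof (rule homI)
    fix h assume "h \<in> carrier C"
    then obtain n :: nat where "h = g [^] n" using ex by metis
    then show "\<phi> h \<in> carrier (BijGroup S)"
      using Bij by (simp add: BijGroup_def \<phi>)
  next
    fix h h' assume "h \<in> carrier C" "h' \<in> carrier C"
    then obtain n m :: nat where nm: "h = g [^] n" "h' = g [^] m"
      using ex by metis
    have "\<phi> (h \<otimes> h') = restrict (f ^^ (n + m)) S"
      using g by (simp add: nm nat_pow_mult \<phi>)
    also have "\<dots> = compose S (restrict (f ^^ n) S) (restrict (f ^^ m) S)"
      using clp by (auto simp: compose_def restrict_def funpow_add)
    also have "\<dots> = \<phi> h \<otimes>\<^bsub>BijGroup S\<^esub> \<phi> h'"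
      using Bij by (simp add: nm \<phi> BijGroup_def)
    finally show "\<phi> (h \<otimes> h') = \<phi> h \<otimes>\<^bsub>BijGroup S\<^esub> \<phi> h'" .
  qed
  then have "group_action C S \<phi>"
    using group_BijGroup is_group
    by (simp add: group_action_def group_hom_def group_hom_axioms_def)
  then show thesis using \<phi> that by blast
qed

context hook_tableaux
begin

section \<open>Tableaux as covering pairs of sets\<close>

definition entry_sets :: "(box \<Rightarrow> nat) \<Rightarrow> nat set \<times> nat set" where
  "entry_sets T = (reflected_range M arm_length (arm T), reflected_range M r (leg T))"

lemma entry_ranges:
  assumes "T \<in> X"
  shows "arm T ` {..<arm_length} \<subseteq> {2..M + 1}" "leg T ` {..<r} \<subseteq> {2..M + 1}"
  using assms unfolding Inc_hook_iff by auto

text \<open>An increasing sequence is determined by its range, which gives injectivity. Every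
  covering pair occurs, since no inequality relates an arm box to a leg box.\<close>

lemma bij_betw_entry_sets:
  "bij_betw entry_sets X {(A, B). A \<union> B = {..<M} \<and> card A = arm_length \<and> card B = r}"
proof (rule bij_betw_imageI)
  show "inj_on entry_sets X"
  proof (rule inj_onI)
    fix T U assume TU: "T \<in> X" "U \<in> X" "entry_sets T = entry_sets U"
    have arm: "arm T j = arm U j" if "j < arm_length" for j
      using TU that entry_ranges
      by (intro reflected_range_inj[of arm_length "arm T" M "arm U"]) (auto simp: entry_sets_def Inc_hook_iff)
    have leg: "leg T j = leg U j" if "j < r" for j
      using TU that entry_ranges
      by (intro reflected_range_inj[of r "leg T" M "leg U"]) (auto simp: entry_sets_def Inc_hook_iff)
    show "T = U"
    proof (rule extensionalityI)
      show "T \<in> extensional Y" "U \<in> extensional Y" using TU by (auto simp: Inc_hook_iff)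
      fix p assume "p \<in> Y"
      then show "T p = U p"
        using arm leg TU(1,2) unfolding Y_eq by (auto simp: arm_def leg_def Inc_hook_iff)
    qed
  qed
  show "entry_sets ` X = {(A, B). A \<union> B = {..<M} \<and> card A = arm_length \<and> card B = r}"
  proof (intro equalityI subsetI)
    fix p assume "p \<in> entry_sets ` X"
    then obtain T where T: "T \<in> X" "p = entry_sets T" by blast
    then show "p \<in> {(A, B). A \<union> B = {..<M} \<and> card A = arm_length \<and> card B = r}"
      using reflected_range_cover_iff[OF entry_ranges[OF T(1)]] entry_ranges[OF T(1)]
      by (simp add: entry_sets_def Inc_hook_iff card_reflected_range)
  next
    fix p assume "p \<in> {(A, B). A \<union> B = {..<M} \<and> card A = arm_length \<and> card B = r}"
    then obtain A B where p: "p = (A, B)" "A \<union> B = {..<M}" "card A = arm_length" "card B = r"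
      by blast
    then have "A \<subseteq> {..<M}" "B \<subseteq> {..<M}" by auto
    obtain f where f: "strict_mono_on {..<arm_length} f" "f ` {..<arm_length} \<subseteq> {2..M + 1}"
        "reflected_range M arm_length f = A"
      using ex_reflected_range[OF \<open>A \<subseteq> {..<M}\<close> p(3)] by blast
    obtain h where h: "strict_mono_on {..<r} h" "h ` {..<r} \<subseteq> {2..M + 1}"
        "reflected_range M r h = B"
      using ex_reflected_range[OF \<open>B \<subseteq> {..<M}\<close> p(4)] by blast
    \<comment> \<open>\<open>f\<close> and \<open>h\<close> start at index 0, hence the offset 2;
      all boxes of \<open>Y\<close> with \<open>i \<noteq> 1\<close> lie in the first
      column.\<close>
    define T where "T = restrict (\<lambda>(i, j). if i = 1 then if j = 1 then 1 else f (j - 2) else h (i - 2)) Y"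
    have arm: "arm T j = f j" if "j < arm_length" for j
      using that by (simp add: T_def arm_def mem_Y)
    have leg: "leg T j = h j" if "j < r" for j
      using that by (simp add: T_def leg_def mem_Y)
    have "strict_mono_on {..<arm_length} (arm T)" "strict_mono_on {..<r} (leg T)"
      using f(1) h(1) arm leg by (auto simp: strict_mono_on_def)
    moreover have "arm T ` {..<arm_length} = f ` {..<arm_length}" "leg T ` {..<r} = h ` {..<r}"
      using arm leg by auto
    moreover have "f ` {..<arm_length} \<union> h ` {..<r} = {2..M + 1}"
      using reflected_range_cover_iff[OF f(2) h(2)] f(3) h(3) p(2) by simp
    ultimately have "T \<in> X"
      unfolding Inc_hook_iff by (simp add: T_def mem_Y)
    moreover have "entry_sets T = p"
      using arm leg f(3) h(3) by (auto simp: p(1) entry_sets_def reflected_range_def)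
    ultimately show "p \<in> entry_sets ` X" by blast
  qed
qed

text \<open>The shift permutes \<open>{..<M}\<close>, so the images of a covering pair cover again.
  With the monotonicity and range of the rotated sequences this shows that promotion stays in
  \<open>X\<close>.\<close>

lemma
  assumes "T \<in> X"
  shows K_promotion_closed: "K_promotion (hook N r) T \<in> X"
    and entry_sets_K_promotion: "entry_sets (K_promotion (hook N r) T)
      = map_prod ((`) (\<lambda>x. (x + 1) mod M)) ((`) (\<lambda>x. (x + 1) mod M)) (entry_sets T)"
proof -
  let ?K = "K_promotion (hook N r) T"
  note K = K_promotion_hook[OF assms]
  note ran = entry_ranges[OF assms]
  have mono: "strict_mono_on {..<arm_length} (arm T)" "strict_mono_on {..<r} (leg T)"
    using assms by (auto simp: Inc_hook_iff)
  have mono': "strict_mono_on {..<arm_length} (arm ?K)" "strict_mono_on {..<r} (leg ?K)"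
    using rotate_seq_strict_mono[OF mono(1) ran(1)] rotate_seq_strict_mono[OF mono(2) ran(2)] K(2,3)
    by (auto simp: strict_mono_on_def)
  have ran': "arm ?K ` {..<arm_length} \<subseteq> {2..M + 1}" "leg ?K ` {..<r} \<subseteq> {2..M + 1}"
    using rotate_seq_range[OF mono(1) ran(1)] rotate_seq_range[OF mono(2) ran(2)] K(2,3)
    by (auto simp: image_subset_iff)
  have "reflected_range M arm_length (arm ?K) = reflected_range M arm_length (rotate_seq M arm_length (arm T))"
    "reflected_range M r (leg ?K) = reflected_range M r (rotate_seq M r (leg T))"
    using K(2,3) by (auto simp: reflected_range_def)
  then show sets: "entry_sets ?K
      = map_prod ((`) (\<lambda>x. (x + 1) mod M)) ((`) (\<lambda>x. (x + 1) mod M)) (entry_sets T)"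
    by (simp only: entry_sets_def map_prod_simp
        reflected_range_rotate_seq[OF mono(1) ran(1)] reflected_range_rotate_seq[OF mono(2) ran(2)])
  have "reflected_range M arm_length (arm T) \<union> reflected_range M r (leg T) = {..<M}"
    using reflected_range_cover_iff[OF ran] assms by (simp add: Inc_hook_iff)
  then have "reflected_range M arm_length (arm ?K) \<union> reflected_range M r (leg ?K) = {..<M}"
    using sets mod_shift_image[OF M_pos, of 1] by (simp add: entry_sets_def flip: image_Un)
  then have "arm ?K ` {..<arm_length} \<union> leg ?K ` {..<r} = {2..M + 1}"
    using reflected_range_cover_iff[OF ran'] by simp
  moreover have "?K \<in> extensional Y"
    by (simp add: K_promotion_def Let_def split: prod.split)
  ultimately show "?K \<in> X"
    unfolding Inc_hook_iff using K(1) mono' by blast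
qed

lemma entry_sets_subset:
  assumes "T \<in> X"
  shows "fst (entry_sets T) \<subseteq> {..<M}" "snd (entry_sets T) \<subseteq> {..<M}"
proof -
  have "entry_sets T \<in> {(A, B). A \<union> B = {..<M} \<and> card A = arm_length \<and> card B = r}"
    using bij_betw_entry_sets assms by (rule bij_betw_apply)
  then have "fst (entry_sets T) \<union> snd (entry_sets T) = {..<M}"
    by (simp add: case_prod_beta)
  then show "fst (entry_sets T) \<subseteq> {..<M}" "snd (entry_sets T) \<subseteq> {..<M}" by blast+
qed

lemma
  assumes "T \<in> X"
  shows K_promotion_funpow_closed: "(K_promotion (hook N r) ^^ d) T \<in> X"
    and entry_sets_funpow: "entry_sets ((K_promotion (hook N r) ^^ d) T)
      = map_prod ((`) (\<lambda>x. (x + d) mod M)) ((`) (\<lambda>x. (x + d) mod M)) (entry_sets T)"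
proof (induction d)
  case 0
  have id: "(\<lambda>x. x mod M) ` A = A" if "A \<subseteq> {..<M}" for A
  proof -
    have "(\<lambda>x. x mod M) ` A = id ` A"
      using that by (intro image_cong) auto
    then show ?thesis by simp
  qed
  show "(K_promotion (hook N r) ^^ 0) T \<in> X" using assms by simp
  show "entry_sets ((K_promotion (hook N r) ^^ 0) T)
      = map_prod ((`) (\<lambda>x. (x + 0) mod M)) ((`) (\<lambda>x. (x + 0) mod M)) (entry_sets T)"
    using id entry_sets_subset[OF assms] by (simp add: prod_eq_iff)
next
  case (Suc d)
  then show "(K_promotion (hook N r) ^^ Suc d) T \<in> X"
    by (simp add: K_promotion_closed)
  show "entry_sets ((K_promotion (hook N r) ^^ Suc d) T)
      = map_prod ((`) (\<lambda>x. (x + Suc d) mod M)) ((`) (\<lambda>x. (x + Suc d) mod M)) (entry_sets T)"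
    using Suc entry_sets_K_promotion[OF Suc(1)]
    by (simp add: prod_eq_iff image_image mod_Suc_eq)
qed

text \<open>\<open>entry_sets\<close> is injective on \<open>X\<close> and turns iterates of
  promotion into shifts.\<close>

lemma K_promotion_fixed_iff:
  assumes "T \<in> X"
  shows "(K_promotion (hook N r) ^^ d) T = T \<longleftrightarrow>
    (\<lambda>x. (x + d) mod M) ` fst (entry_sets T) = fst (entry_sets T) \<and>
    (\<lambda>x. (x + d) mod M) ` snd (entry_sets T) = snd (entry_sets T)"
proof -
  have "(K_promotion (hook N r) ^^ d) T = T \<longleftrightarrow>
      entry_sets ((K_promotion (hook N r) ^^ d) T) = entry_sets T"
    using bij_betw_imp_inj_on[OF bij_betw_entry_sets] K_promotion_funpow_closed[OF assms] assms
    by (auto dest: inj_onD)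
  then show ?thesis
    by (simp add: entry_sets_funpow[OF assms] prod_eq_iff)
qed

lemma K_promotion_period:
  assumes "T \<in> X"
  shows "(K_promotion (hook N r) ^^ M) T = T"
proof -
  have "(\<lambda>x. (x + M) mod M) ` A = A" if "A \<subseteq> {..<M}" for A
  proof -
    have "(\<lambda>x. (x + M) mod M) ` A = id ` A"
      using that by (intro image_cong) auto
    then show ?thesis by simp
  qed
  then show ?thesis
    using K_promotion_fixed_iff[OF assms] entry_sets_subset[OF assms] by simp
qed

lemma finite_Inc: "finite X"
proof -
  have "finite {(A, B). A \<union> B = {..<M} \<and> card A = arm_length \<and> card B = r}"
    by (rule finite_subset[of _ "Pow {..<M} \<times> Pow {..<M}"]) auto
  then show ?thesis
    using bij_betw_finite[OF bij_betw_entry_sets] by blast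
qed

lemma card_K_promotion_fixed:
  assumes g: "g = gcd d M" and e: "e = M div g"
  shows "card {T \<in> X. (K_promotion (hook N r) ^^ d) T = T}
    = (if e dvd r \<and> e dvd k then (g choose (r div e)) * ((r div e) choose (k div e)) else 0)"
proof -
  let ?F = "{T \<in> X. (K_promotion (hook N r) ^^ d) T = T}"
  let ?s = "\<lambda>x. (x + d) mod M"
  let ?Z = "{(A, B). A \<union> B = {..<M} \<and> card A = arm_length \<and> card B = r}"
  have F: "?F = {T \<in> X. ?s ` fst (entry_sets T) = fst (entry_sets T) \<and>
      ?s ` snd (entry_sets T) = snd (entry_sets T)}"
    by (rule Collect_cong) (use K_promotion_fixed_iff in blast)
  have "card ?F = card (entry_sets ` ?F)"
    using bij_betw_imp_inj_on[OF bij_betw_entry_sets]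
    by (intro card_image[symmetric]) (auto elim: inj_on_subset)
  also have "entry_sets ` ?F = {p \<in> entry_sets ` X. ?s ` fst p = fst p \<and> ?s ` snd p = snd p}"
    unfolding F by blast
  also have "\<dots> = {(A, B). A \<union> B = {..<M} \<and> card A = arm_length \<and> card B = r \<and> ?s ` A = A \<and> ?s ` B = B}"
    unfolding bij_betw_imp_surj_on[OF bij_betw_entry_sets] by auto
  also have "card \<dots> =
      (if e dvd r \<and> e dvd k then (g choose (r div e)) * ((r div e) choose (k div e)) else 0)"
    \<comment> \<open>Both \<open>arm_length + r\<close> and \<open>M + k\<close> equal
      \<open>N - 1\<close>, as the counting lemma requires.\<close>
    using arm_length_eq N_eq
    by (intro card_invariant_covering_pairs[OF M_pos g e _ k_le]) simp
  finally show ?thesis .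
qed

end

lemma q_binomial_product_root_of_unity:
  fixes M d r k :: nat
  assumes "0 < M" and g: "g = gcd d M" and e: "e = M div g"
  shows "int_poly_eval (exp (2 * of_real pi * \<i> / of_nat M) ^ d) (q_binomial M r * q_binomial r k)
    = of_nat (if e dvd r \<and> e dvd k then (g choose (r div e)) * ((r div e) choose (k div e)) else 0)"
proof -
  define z :: complex where "z = exp (2 * of_real pi * \<i> / of_nat M) ^ d"
  have root: "z ^ j = 1 \<longleftrightarrow> e dvd j" for j
    unfolding z_def e g by (rule exp_root_of_unity_power_eq_1_iff[OF \<open>0 < M\<close>])
  have M: "g * e = M" unfolding e g by simp
  then have "0 < e" using \<open>0 < M\<close> by (cases e) auto
  note lucas = q_Lucas[of z e, OF root \<open>0 < e\<close>]
  have "int_poly_eval z (q_binomial M r) = (if e dvd r then of_nat (g choose (r div e)) else 0)"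
    using lucas[of g r] unfolding M .
  \<comment> \<open>The second factor is evaluated only for \<open>e dvd r\<close>, where
    \<open>q_Lucas\<close> applies to the upper index \<open>r\<close>; otherwise the first factor
    already makes the product 0.\<close>
  moreover have "int_poly_eval z (q_binomial r k)
      = (if e dvd k then of_nat ((r div e) choose (k div e)) else 0)" if "e dvd r"
    using lucas[of "r div e" k] that by (simp only: dvd_div_mult_self)
  ultimately show ?thesis
    unfolding z_def[symmetric] by simp
qed

theorem theorem3p7:
  fixes N r k :: nat and C :: "('g, 'm) monoid_scheme" and g :: 'g
  assumes "1 \<le> N" and "r < N" and "k \<le> r"
    and "group C" and "finite (carrier C)" and "card (carrier C) = N - k - 1"
    and "g \<in> carrier C" and "subgroup_generated C {g} = C"
  shows "\<exists>\<phi>. \<phi> g = restrict (K_promotion (hook N r)) (Inc k (hook N r)) \<and>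
             cyclic_sieving (Inc k (hook N r)) C g \<phi>
               (q_binomial (N - k - 1) r * q_binomial r k)"
proof -
  define M where "M = N - k - 1"
  \<comment> \<open>\<open>C\<close> contains \<open>g\<close>, so its order
    \<open>N - k - 1\<close> is positive; hence the subtraction does not truncate and
    \<open>0 < M\<close>.\<close>
  have "card (carrier C) > 0"
    using assms(5,7) by (auto simp: card_gt_0_iff)
  then have M: "0 < M" "N = M + k + 1" "card (carrier C) = M"
    using assms(6) by (auto simp: M_def)
  interpret hook_tableaux N r k M
    using M assms(2,3) by unfold_locales
  interpret C: group C by (rule assms(4))
  obtain \<phi> where act: "group_action C X \<phi>"
    and \<phi>: "\<And>d. \<phi> (g [^]\<^bsub>C\<^esub> (d::nat)) = restrict (K_promotion (hook N r) ^^ d) X"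
    using cyclic_group_action[OF assms(4,5) M(3) assms(7,8), of X "K_promotion (hook N r)"]
      K_promotion_closed K_promotion_period by blast
  have "\<phi> g = restrict (K_promotion (hook N r)) X"
    using \<phi>[of 1] assms(7) by simp
  moreover have "poly (map_poly of_int (q_binomial M r * q_binomial r k))
        (exp (2 * of_real pi * \<i> / of_nat M) ^ d)
      = (of_nat (card {T \<in> X. \<phi> (g [^]\<^bsub>C\<^esub> d) T = T}) :: complex)" for d :: nat
  proof -
    have "{T \<in> X. \<phi> (g [^]\<^bsub>C\<^esub> d) T = T} = {T \<in> X. (K_promotion (hook N r) ^^ d) T = T}"
      by (auto simp: \<phi>)
    then show ?thesis
      using q_binomial_product_root_of_unity[OF M(1) refl refl, of d r k]
        card_K_promotion_fixed[OF refl refl, of d]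
      by (simp only: int_poly_eval_def)
  qed
  ultimately show ?thesis
    unfolding cyclic_sieving_def M_def[symmetric] M(3)
    using assms(4,5,7,8) finite_Inc act by blast
qed

end
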